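(* Let $r$ be a smooth positive function with $|r'(u)|<1$, $\cos\beta=\sqrt{1-r'^2}$, $\sin\beta=r'$, $\beta\in(-\pi/2,\pi/2)$, and let $M$ be the surface of revolution parametrized by $$H(u,v)=r\cos\beta\,(\cos v,\sin v,0)+(0,0,u-r\sin\beta),$$ the envelope of the spheres of radius $r(u)$ centered at $(0,0,u)$. Assume that $M$ is free of umbilic points and $k_2>k_1$. Then the Darboux curves on $M$ can be integrated by quadratures: the function $$\mathcal I(u,\alpha)=r\cos\beta\,(k_1-k_2)\cos^3\alpha=h(u)(k_1-k_2)\cos^3\alpha$$ is a first integral of the differential equation of Darboux curves, where $h$ is the distance of the point of the surface to the axis of revolution and $\alpha$ is the angle of the curve with the meridians ($v=$ const). Moreover, the ridge set (relative to $k_1$) is defined by $R(u)=r'''(1-r'^2)+3r'r''^2=0$; if $R'(u)<0$ at such a ridge, the ridge is zigzag, and if $R'(u)>0$, it is beak to beak.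
   Context: In the chart $(u,v)$, with unit normal $N=(-\cos\beta\cos v,-\cos\beta\sin v,\sin\beta)$, the principal curvatures are $k_1=-\frac{r''}{1-r'^2-rr''}$ (along $v=$ const) and $k_2=\frac1r$ (along $u=$ const), where $1-r'^2-rr''\ne0$. A Darboux curve is a curve whose osculating sphere at each point is tangent to the surface. In a principal chart with $I=E\,du^2+G\,dv^2$, for an arc-length parametrized curve with $(u',v')=(\frac{\cos\alpha}{\sqrt E},\frac{\sin\alpha}{\sqrt G})$, its differential equation is $3(k_1-k_2)\sin\alpha\cos\alpha\,\alpha'=\frac1{\sqrt E}\frac{\partial k_1}{\partial u}\cos^3\alpha+\frac1{\sqrt G}\frac{\partial k_2}{\partial v}\sin^3\alpha$. A ridge point relative to $k_1$ is a point where $\partial k_1/\partial u=0$; it is called zigzag if $\sigma_1=\frac{\partial^2k_1}{\partial u^2}/(k_1-k_2)<0$ and beak to beak if $\sigma_1>0$. *)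

theory Defs
  imports "HOL-Analysis.Analysis"
begin

section \<open>Smooth functions of one real variable\<close>

text \<open>For open \<open>S\<close> this is the usual notion of \<open>C\<^sup>\<infinity>\<close> on \<open>S\<close>.\<close>

definition smooth_on :: "real set \<Rightarrow> (real \<Rightarrow> real) \<Rightarrow> bool" where
  "smooth_on S f \<longleftrightarrow> (\<forall>n. (deriv ^^ n) f differentiable_on S)"

section \<open>Parametrized surfaces in Euclidean 3-space\<close>

text \<open>Partial derivatives of a function of the chart coordinates \<open>(u,v)\<close>.\<close>

definition du :: "(real \<Rightarrow> real \<Rightarrow> 'a::real_normed_vector) \<Rightarrow> real \<Rightarrow> real \<Rightarrow> 'a" where
  "du X u v = vector_derivative (\<lambda>t. X t v) (at u)"

definition dv :: "(real \<Rightarrow> real \<Rightarrow> 'a::real_normed_vector) \<Rightarrow> real \<Rightarrow> real \<Rightarrow> 'a" where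
  "dv X u v = vector_derivative (\<lambda>t. X u t) (at v)"

definition form_E :: "(real \<Rightarrow> real \<Rightarrow> real^3) \<Rightarrow> real \<Rightarrow> real \<Rightarrow> real" where
  "form_E X u v = du X u v \<bullet> du X u v"

definition form_G :: "(real \<Rightarrow> real \<Rightarrow> real^3) \<Rightarrow> real \<Rightarrow> real \<Rightarrow> real" where
  "form_G X u v = dv X u v \<bullet> dv X u v"

text \<open>
  \<open>N\<close> is a unit normal field and the coordinate lines are orthogonal lines of curvature, with
  principal curvatures \<open>k1\<close> along \<open>v = const\<close> and \<open>k2\<close> along \<open>u = const\<close> (formula of Rodrigues).
\<close>

definition principal_chart ::
  "(real \<Rightarrow> real \<Rightarrow> real^3) \<Rightarrow> (real \<Rightarrow> real \<Rightarrow> real^3) \<Rightarrow> (real \<Rightarrow> real \<Rightarrow> real) \<Rightarrow>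
   (real \<Rightarrow> real \<Rightarrow> real) \<Rightarrow> (real \<times> real) set \<Rightarrow> bool" where
  "principal_chart X N k1 k2 D \<longleftrightarrow> (\<forall>(u, v)\<in>D.
     du X u v \<noteq> 0 \<and> dv X u v \<noteq> 0 \<and> du X u v \<bullet> dv X u v = 0 \<and>
     norm (N u v) = 1 \<and> N u v \<bullet> du X u v = 0 \<and> N u v \<bullet> dv X u v = 0 \<and>
     (\<lambda>t. N t v) differentiable (at u) \<and> (\<lambda>t. N u t) differentiable (at v) \<and>
     du N u v = - k1 u v *\<^sub>R du X u v \<and> dv N u v = - k2 u v *\<^sub>R dv X u v)"

text \<open>The shape operator is a multiple of the identity.\<close>

definition umbilic_point ::
  "(real \<Rightarrow> real \<Rightarrow> real^3) \<Rightarrow> (real \<Rightarrow> real \<Rightarrow> real^3) \<Rightarrow> real \<Rightarrow> real \<Rightarrow> bool" where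
  "umbilic_point X N u v \<longleftrightarrow>
     (\<exists>k. du N u v = - k *\<^sub>R du X u v \<and> dv N u v = - k *\<^sub>R dv X u v)"

section \<open>Darboux curves\<close>

text \<open>
  Spheres are written as zero sets \<open>a (x \<bullet> x) + b \<bullet> x + d = 0\<close>, so that planes (\<open>a = 0\<close>) count as
  spheres of infinite radius; they occur where the normal curvature of the curve vanishes.  The
  vector \<open>2 a \<gamma> s + b\<close> is the gradient at \<open>\<gamma> s\<close>; requiring it to be nonzero excludes
  spheres of radius zero and makes it a normal vector of the sphere at \<open>\<gamma> s\<close>.
  An osculating sphere has contact of order at least three with the curve.
\<close>

definition osculating_sphere_at ::
  "(real \<Rightarrow> real^3) \<Rightarrow> real \<Rightarrow> real \<Rightarrow> real^3 \<Rightarrow> real \<Rightarrow> bool" where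
  "osculating_sphere_at \<gamma> s a b d \<longleftrightarrow>
     (2 * a) *\<^sub>R \<gamma> s + b \<noteq> 0 \<and>
     (\<forall>k\<le>3. (deriv ^^ k) (\<lambda>t. a * (\<gamma> t \<bullet> \<gamma> t) + b \<bullet> \<gamma> t + d) s = 0)"

definition darboux_curve_on ::
  "(real \<Rightarrow> real \<Rightarrow> real^3) \<Rightarrow> real set \<Rightarrow> (real \<Rightarrow> real) \<Rightarrow> (real \<Rightarrow> real) \<Rightarrow> bool" where
  "darboux_curve_on X J u v \<longleftrightarrow> (\<forall>s\<in>J. \<exists>a b d.
     osculating_sphere_at (\<lambda>t. X (u t) (v t)) s a b d \<and>
     ((2 * a) *\<^sub>R X (u s) (v s) + b) \<bullet> du X (u s) (v s) = 0 \<and>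
     ((2 * a) *\<^sub>R X (u s) (v s) + b) \<bullet> dv X (u s) (v s) = 0)"

text \<open>
  In an orthogonal chart: \<open>s \<mapsto> X (u s) (v s)\<close> is parametrized by arc length and makes the
  angle \<open>\<alpha> s\<close> with the coordinate line \<open>v = const\<close>.
\<close>

definition arc_length_with_angle ::
  "(real \<Rightarrow> real \<Rightarrow> real^3) \<Rightarrow> real set \<Rightarrow> (real \<Rightarrow> real) \<Rightarrow> (real \<Rightarrow> real) \<Rightarrow> (real \<Rightarrow> real) \<Rightarrow> bool" where
  "arc_length_with_angle X J u v \<alpha> \<longleftrightarrow> (\<forall>s\<in>J.
     (u has_real_derivative cos (\<alpha> s) / sqrt (form_E X (u s) (v s))) (at s) \<and>
     (v has_real_derivative sin (\<alpha> s) / sqrt (form_G X (u s) (v s))) (at s))"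

text \<open>
  Solutions of the differential equation of Darboux curves in a principal chart with principal
  curvatures \<open>k1\<close>, \<open>k2\<close>.
\<close>

definition darboux_ode_solution ::
  "(real \<Rightarrow> real \<Rightarrow> real^3) \<Rightarrow> (real \<Rightarrow> real \<Rightarrow> real) \<Rightarrow> (real \<Rightarrow> real \<Rightarrow> real) \<Rightarrow> real set \<Rightarrow>
   (real \<Rightarrow> real) \<Rightarrow> (real \<Rightarrow> real) \<Rightarrow> (real \<Rightarrow> real) \<Rightarrow> bool" where
  "darboux_ode_solution X k1 k2 J u v \<alpha> \<longleftrightarrow>
     arc_length_with_angle X J u v \<alpha> \<and> (\<forall>s\<in>J. \<exists>\<alpha>'.
       (\<alpha> has_real_derivative \<alpha>') (at s) \<and>
       3 * (k1 (u s) (v s) - k2 (u s) (v s)) * sin (\<alpha> s) * cos (\<alpha> s) * \<alpha>'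
         = 1 / sqrt (form_E X (u s) (v s)) * du k1 (u s) (v s) * cos (\<alpha> s) ^ 3
         + 1 / sqrt (form_G X (u s) (v s)) * dv k2 (u s) (v s) * sin (\<alpha> s) ^ 3)"

section \<open>Ridge points\<close>

definition ridge_point :: "(real \<Rightarrow> real \<Rightarrow> real) \<Rightarrow> real \<Rightarrow> real \<Rightarrow> bool" where
  "ridge_point k1 u v \<longleftrightarrow> du k1 u v = 0"

definition sigma1 ::
  "(real \<Rightarrow> real \<Rightarrow> real) \<Rightarrow> (real \<Rightarrow> real \<Rightarrow> real) \<Rightarrow> real \<Rightarrow> real \<Rightarrow> real" where
  "sigma1 k1 k2 u v = du (du k1) u v / (k1 u v - k2 u v)"

definition zigzag_ridge_point ::
  "(real \<Rightarrow> real \<Rightarrow> real) \<Rightarrow> (real \<Rightarrow> real \<Rightarrow> real) \<Rightarrow> real \<Rightarrow> real \<Rightarrow> bool" where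
  "zigzag_ridge_point k1 k2 u v \<longleftrightarrow> ridge_point k1 u v \<and> sigma1 k1 k2 u v < 0"

definition beak_to_beak_ridge_point ::
  "(real \<Rightarrow> real \<Rightarrow> real) \<Rightarrow> (real \<Rightarrow> real \<Rightarrow> real) \<Rightarrow> real \<Rightarrow> real \<Rightarrow> bool" where
  "beak_to_beak_ridge_point k1 k2 u v \<longleftrightarrow> ridge_point k1 u v \<and> sigma1 k1 k2 u v > 0"

section \<open>The surface of revolution\<close>

text \<open>
  The angle in \<open>(-\<pi>/2, \<pi>/2)\<close> with \<open>sin \<beta> = r'\<close> and \<open>cos \<beta> = sqrt (1 - r'\<^sup>2)\<close>, for \<open>\<bar>r'\<bar> < 1\<close>.
\<close>

definition rev_beta :: "(real \<Rightarrow> real) \<Rightarrow> real \<Rightarrow> real" where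
  "rev_beta r u = arcsin (deriv r u)"

definition rev_H :: "(real \<Rightarrow> real) \<Rightarrow> real \<Rightarrow> real \<Rightarrow> real^3" where
  "rev_H r u v = (r u * cos (rev_beta r u)) *\<^sub>R vector [cos v, sin v, 0]
                 + vector [0, 0, u - r u * sin (rev_beta r u)]"

definition rev_N :: "(real \<Rightarrow> real) \<Rightarrow> real \<Rightarrow> real \<Rightarrow> real^3" where
  "rev_N r u v = vector [- (cos (rev_beta r u) * cos v), - (cos (rev_beta r u) * sin v),
                         sin (rev_beta r u)]"

text \<open>
  The principal curvatures of \<open>rev_H r\<close> with respect to \<open>rev_N r\<close>; see
  \<open>rev_principal_chart\<close> below.
\<close>

definition rev_k1 :: "(real \<Rightarrow> real) \<Rightarrow> real \<Rightarrow> real" where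
  "rev_k1 r u = - deriv (deriv r) u / (1 - (deriv r u)\<^sup>2 - r u * deriv (deriv r) u)"

definition rev_k2 :: "(real \<Rightarrow> real) \<Rightarrow> real \<Rightarrow> real" where
  "rev_k2 r u = 1 / r u"

definition rev_axis :: "(real^3) set" where
  "rev_axis = {x. x $ 1 = 0 \<and> x $ 2 = 0}"

text \<open>Distance to the axis of the points with parameter \<open>u\<close>; it does not depend on \<open>v\<close>.\<close>

definition rev_h :: "(real \<Rightarrow> real) \<Rightarrow> real \<Rightarrow> real" where
  "rev_h r u = infdist (rev_H r u 0) rev_axis"

definition darboux_integral :: "(real \<Rightarrow> real) \<Rightarrow> real \<Rightarrow> real \<Rightarrow> real" where
  "darboux_integral r u \<alpha> = r u * cos (rev_beta r u) * (rev_k1 r u - rev_k2 r u) * cos \<alpha> ^ 3"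

definition ridge_function :: "(real \<Rightarrow> real) \<Rightarrow> real \<Rightarrow> real" where
  "ridge_function r u = (deriv ^^ 3) r u * (1 - (deriv r u)\<^sup>2) + 3 * deriv r u * ((deriv ^^ 2) r u)\<^sup>2"

text \<open>
  On the level \<open>darboux_integral r u \<alpha> = c\<close> the cosine of the angle is determined by \<open>u\<close>
  (\<open>root 3\<close> is the odd real root), and \<open>sin \<alpha>\<close> is determined up to a sign \<open>\<epsilon>\<close>.
\<close>

definition level_cos :: "(real \<Rightarrow> real) \<Rightarrow> real \<Rightarrow> real \<Rightarrow> real" where
  "level_cos r c u = root 3 (c / (rev_h r u * (rev_k1 r u - rev_k2 r u)))"

text \<open>
  Integration by quadratures.  Dividing \<open>v' = sin \<alpha> / sqrt G\<close> and \<open>1\<close> by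
  \<open>u' = cos \<alpha> / sqrt E\<close> gives \<open>v\<close> and the arc length \<open>s\<close> as integrals with respect to \<open>u\<close>, on
  every arc on which \<open>\<epsilon> sin \<alpha> \<ge> 0\<close>.  If \<open>c = 0\<close> the curve is a parallel \<open>u = const\<close>.  The
  coefficients \<open>E\<close> and \<open>G\<close> do not depend on \<open>v\<close>, so they are taken at \<open>v = 0\<close>.
\<close>

definition given_by_quadratures ::
  "(real \<Rightarrow> real) \<Rightarrow> real \<Rightarrow> real set \<Rightarrow> (real \<Rightarrow> real) \<Rightarrow> (real \<Rightarrow> real) \<Rightarrow> (real \<Rightarrow> real) \<Rightarrow> bool" where
  "given_by_quadratures r c J u v \<alpha> \<longleftrightarrow>
     (\<forall>s\<in>J. \<forall>t\<in>J. \<forall>\<epsilon>\<in>{-1, 1}. (\<forall>x\<in>closed_segment s t. 0 \<le> \<epsilon> * sin (\<alpha> x)) \<longrightarrow>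
       (if c = 0 then
          u t = u s \<and> v t - v s = \<epsilon> * (t - s) / sqrt (form_G (rev_H r) (u s) 0)
        else
          v t - v s = (LBINT x=u s..u t. sqrt (form_E (rev_H r) x 0 / form_G (rev_H r) x 0)
                         * (\<epsilon> * sqrt (1 - (level_cos r c x)\<^sup>2) / level_cos r c x)) \<and>
          t - s = (LBINT x=u s..u t. sqrt (form_E (rev_H r) x 0) / level_cos r c x)))"

lemma has_vector_derivative_vector3:
  assumes "(f has_real_derivative f') (at t)" "(g has_real_derivative g') (at t)"
    "(h has_real_derivative h') (at t)"
  shows "((\<lambda>t. vector [f t, g t, h t] :: real^3) has_vector_derivative vector [f', g', h']) (at t)"
proof -
  have eq: "(vector [x, y, z] :: real^3) =
      x *\<^sub>R vector [1, 0, 0] + y *\<^sub>R vector [0, 1, 0] + z *\<^sub>R vector [0, 0, 1]" for x y z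
    by (simp add: vec_eq_iff forall_3)
  have "((\<lambda>t. f t *\<^sub>R (vector [1, 0, 0] :: real^3) + g t *\<^sub>R vector [0, 1, 0] + h t *\<^sub>R vector [0, 0, 1])
      has_vector_derivative
      (f' *\<^sub>R vector [1, 0, 0] + g' *\<^sub>R vector [0, 1, 0] + h' *\<^sub>R vector [0, 0, 1])) (at t)"
    by (intro has_vector_derivative_add has_vector_derivative_scaleR[where g' = 0, simplified]
        assms has_vector_derivative_const)
  then show ?thesis by (simp only: eq[symmetric])
qed

lemma rev_principal_chart:
  assumes "open U" "smooth_on U r"
    and pos: "\<And>u. u \<in> U \<Longrightarrow> r u > 0" and less: "\<And>u. u \<in> U \<Longrightarrow> \<bar>deriv r u\<bar> < 1"
    and reg: "\<And>u. u \<in> U \<Longrightarrow> 1 - (deriv r u)\<^sup>2 - r u * deriv (deriv r) u \<noteq> 0"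
  shows "principal_chart (rev_H r) (rev_N r) (\<lambda>u v. rev_k1 r u) (\<lambda>u v. rev_k2 r u) (U \<times> UNIV)"
proof -
  have "r differentiable_on U" "deriv r differentiable_on U"
    using assms(2)[unfolded smooth_on_def, rule_format, of 0]
      assms(2)[unfolded smooth_on_def, rule_format, of 1] by simp_all
  then have d: "(r has_real_derivative deriv r u) (at u)"
    "(deriv r has_real_derivative deriv (deriv r) u) (at u)" if "u \<in> U" for u
    unfolding DERIV_deriv_iff_real_differentiable differentiable_on_def
    using that at_within_open[OF that assms(1)] by force+
  have "du (rev_H r) u v \<noteq> 0 \<and> dv (rev_H r) u v \<noteq> 0 \<and> du (rev_H r) u v \<bullet> dv (rev_H r) u v = 0 \<and>
     norm (rev_N r u v) = 1 \<and> rev_N r u v \<bullet> du (rev_H r) u v = 0 \<and> rev_N r u v \<bullet> dv (rev_H r) u v = 0 \<and>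
     (\<lambda>t. rev_N r t v) differentiable (at u) \<and> (\<lambda>t. rev_N r u t) differentiable (at v) \<and>
     du (rev_N r) u v = - rev_k1 r u *\<^sub>R du (rev_H r) u v \<and>
     dv (rev_N r) u v = - rev_k2 r u *\<^sub>R dv (rev_H r) u v" if u: "u \<in> U" for u v
  proof -
    define c p q W where "c = cos (rev_beta r u)" and "p = deriv r u" and "q = deriv (deriv r) u"
      and "W = 1 - p\<^sup>2 - r u * q"
    have p: "-1 < p" "p < 1" "p\<^sup>2 < 1"
      using less[OF u] by (auto simp: p_def abs_square_less_1)
    have sb: "sin (rev_beta r u) = p" and c_eq: "c = sqrt (1 - p\<^sup>2)"
      using p by (simp_all add: rev_beta_def c_def p_def cos_arcsin)
    have c: "c > 0" "c\<^sup>2 = 1 - p\<^sup>2"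
      using p by (simp_all add: c_eq)
    have W: "W \<noteq> 0" using reg[OF u] by (simp add: W_def p_def q_def)
    have r: "r u > 0" by (rule pos[OF u])
    have db: "(rev_beta r has_real_derivative q / c) (at u)"
    proof -
      have "((\<lambda>x. arcsin (deriv r x)) has_real_derivative inverse (sqrt (1 - p\<^sup>2)) * q) (at u)"
        using DERIV_chain2[OF DERIV_arcsin d(2)[OF u]] p by (simp add: p_def q_def)
      moreover have "rev_beta r = (\<lambda>x. arcsin (deriv r x))" by (simp add: rev_beta_def fun_eq_iff)
      ultimately show ?thesis by (simp add: c_eq divide_inverse mult.commute)
    qed
    note D = d(1)[OF u, folded p_def] db
    have H: "rev_H r = (\<lambda>u v. vector [r u * cos (rev_beta r u) * cos v,
        r u * cos (rev_beta r u) * sin v, u - r u * sin (rev_beta r u)])"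
      by (simp add: rev_H_def fun_eq_iff vec_eq_iff forall_3)
    have N: "rev_N r = (\<lambda>u v. vector [- (cos (rev_beta r u) * cos v), - (cos (rev_beta r u) * sin v),
                         sin (rev_beta r u)])"
      by (simp add: rev_N_def fun_eq_iff)
    have W': "W = c * c - r u * q"
      using c(2) by (simp add: W_def power2_eq_square)
    have hc: "((\<lambda>t. r t * cos (rev_beta r t)) has_real_derivative p * W / c) (at u)"
      by (rule derivative_eq_intros D refl)+
         (use c in \<open>simp add: sb W' field_simps flip: c_def\<close>)
    have hz: "((\<lambda>t. t - r t * sin (rev_beta r t)) has_real_derivative W) (at u)"
      by (rule derivative_eq_intros D refl)+
         (use c in \<open>simp add: sb W_def power2_eq_square flip: c_def\<close>)
    have cb: "((\<lambda>t. cos (rev_beta r t)) has_real_derivative - (p * q / c)) (at u)"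
      by (rule derivative_eq_intros D refl)+ (simp add: sb)
    have sbd: "((\<lambda>t. sin (rev_beta r t)) has_real_derivative q) (at u)"
      by (rule derivative_eq_intros D refl)+ (use c in \<open>simp add: flip: c_def\<close>)
    have Hu: "((\<lambda>t. rev_H r t v) has_vector_derivative
        vector [p * W / c * cos v, p * W / c * sin v, W]) (at u)"
      unfolding H by (intro has_vector_derivative_vector3 DERIV_cmult_right hc hz)
    have Hv: "((\<lambda>t. rev_H r u t) has_vector_derivative
        vector [- (r u * c * sin v), r u * c * cos v, 0]) (at v)"
      unfolding H by (rule has_vector_derivative_vector3; (rule derivative_eq_intros refl)+; simp add: c_def)
    have Nu: "((\<lambda>t. rev_N r t v) has_vector_derivative
        vector [p * q / c * cos v, p * q / c * sin v, q]) (at u)"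
      unfolding N
      by (rule has_vector_derivative_vector3; (rule derivative_eq_intros cb sbd refl)+; simp)
    have Nv: "((\<lambda>t. rev_N r u t) has_vector_derivative vector [c * sin v, - (c * cos v), 0]) (at v)"
      unfolding N by (rule has_vector_derivative_vector3; (rule derivative_eq_intros refl)+; simp add: c_def)
    note vd = vector_derivative_at[OF Hu] vector_derivative_at[OF Hv]
      vector_derivative_at[OF Nu] vector_derivative_at[OF Nv]
    have Nuv: "rev_N r u v = vector [- (c * cos v), - (c * sin v), p]"
      by (simp add: N sb flip: c_def)
    have sc: "x * sin v * (y * sin v) + x * cos v * (y * cos v) = x * y" for x y
    proof -
      have "x * sin v * (y * sin v) + x * cos v * (y * cos v) = x * y * ((sin v)\<^sup>2 + (cos v)\<^sup>2)"
        unfolding power2_eq_square by (simp only: algebra_simps)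
      then show ?thesis by simp
    qed
    have "dv (rev_H r) u v \<noteq> 0"
    proof
      assume "dv (rev_H r) u v = 0"
      then have "sin v = 0" "cos v = 0"
        using c r by (simp_all add: dv_def vd vec_eq_iff forall_3)
      then show False using sin_cos_squared_add[of v] by simp
    qed
    moreover have "du (rev_H r) u v \<noteq> 0"
      using W by (simp add: du_def vd vec_eq_iff forall_3)
    moreover have "du (rev_H r) u v \<bullet> dv (rev_H r) u v = 0" "rev_N r u v \<bullet> dv (rev_H r) u v = 0"
      by (simp_all add: du_def dv_def vd Nuv inner_vec_def sum_3)
    moreover have "norm (rev_N r u v) = 1"
    proof -
      have "rev_N r u v \<bullet> rev_N r u v = 1"
        using sc[of c c] c(2) by (simp add: Nuv inner_vec_def sum_3 power2_eq_square)
      then show ?thesis by (simp add: norm_eq_1)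
    qed
    moreover have "rev_N r u v \<bullet> du (rev_H r) u v = 0"
      using sc[of c "p * W / c"] c(1) by (simp add: du_def vd Nuv inner_vec_def sum_3)
    moreover have "(\<lambda>t. rev_N r t v) differentiable (at u)" "(\<lambda>t. rev_N r u t) differentiable (at v)"
      using Nu Nv by (auto intro: differentiableI_vector)
    moreover have "du (rev_N r) u v = - rev_k1 r u *\<^sub>R du (rev_H r) u v"
      using W c by (simp add: du_def vd vec_eq_iff forall_3 rev_k1_def flip: p_def q_def W_def)
    moreover have "dv (rev_N r) u v = - rev_k2 r u *\<^sub>R dv (rev_H r) u v"
      using r by (simp add: dv_def vd vec_eq_iff forall_3 rev_k2_def)
    ultimately show ?thesis by blast
  qed
  then show ?thesis by (auto simp: principal_chart_def)
qed

end

theory Submission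
  imports Defs
begin

text \<open>
  Write \<open>C = cos \<beta>\<close> and \<open>W = 1 - r'\<^sup>2 - r r''\<close>; then \<open>k\<^sub>1 - k\<^sub>2 = - C\<^sup>2 / (r W)\<close>, so that
  \<open>k\<^sub>1 < k\<^sub>2\<close> means \<open>W > 0\<close>, \<open>sqrt E = W / C\<close>, \<open>sqrt G = r C\<close>, \<open>\<partial>k\<^sub>1/\<partial>u = - R / W\<^sup>2\<close> and
  the integral is \<open>- (C cos \<alpha>)\<^sup>3 / W\<close>.  Its derivative along a solution vanishes because
  \<open>3 r' r'' W + r R = C\<^sup>2 (3 r' r'' + r r''')\<close>.  For a Darboux curve, the moving frame
  \<open>(e\<^sub>1, e\<^sub>2, n)\<close> of the unit principal directions and the normal turns the condition that the
  third derivative of the contact function vanishes into the differential equation; the terms in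
  \<open>sin\<^sup>2 \<alpha>\<close> cancel by the Codazzi equation.  On a level of the integral, \<open>cos \<alpha>\<close> is a function of
  \<open>u\<close>, and the quadratures are the change of variables from arc length to \<open>u\<close>.
\<close>

section \<open>Calculus preliminaries: iterated derivatives and integration along a path\<close>

lemma smooth_on_DERIV:
  assumes "smooth_on S f" "open S" "x \<in> S"
  shows "((deriv ^^ n) f has_real_derivative (deriv ^^ Suc n) f x) (at x)"
proof -
  have "(deriv ^^ n) f differentiable (at x)"
    using assms(1)[unfolded smooth_on_def, rule_format, of n] assms(2,3)
    by (metis at_within_open differentiable_on_def)
  then show ?thesis
    by (simp add: DERIV_deriv_iff_real_differentiable)
qed

text \<open>Both sides equal the integral of \<open>g' x * f (g x)\<close> from \<open>s\<close> to
  \<open>t\<close>, one by substitution and the other by the fundamental theorem of calculus. The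
  interval integral is oriented, so \<open>g\<close> may turn back and \<open>g t < g s\<close> is
  allowed. It serves with the coordinate \<open>u\<close> as \<open>g\<close> and with
  \<open>v\<close> or the arc length itself as \<open>F\<close>.\<close>

lemma interval_integral_along_path:
  fixes f g g' F :: "real \<Rightarrow> real"
  assumes "s \<le> t"
    and g: "\<And>x. s \<le> x \<Longrightarrow> x \<le> t \<Longrightarrow> (g has_real_derivative g' x) (at x)"
    and g': "continuous_on {s..t} g'"
    and f: "continuous_on (g ` {s..t}) f"
    and F: "\<And>x. s \<le> x \<Longrightarrow> x \<le> t \<Longrightarrow> (F has_real_derivative g' x * f (g x)) (at x)"
  shows "(LBINT y=g s..g t. f y) = F t - F s"
proof -
  have "continuous_on {s..t} g"
    using g by (blast intro: DERIV_atLeastAtMost_imp_continuous_on)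
  then have "continuous_on {s..t} (\<lambda>x. g' x * f (g x))"
    by (intro continuous_on_mult g' continuous_on_compose2[OF f]) auto
  then have "(LBINT x=s..t. g' x * f (g x)) = F t - F s"
    using assms(1) F
    by (intro interval_integral_FTC_finite)
      (auto simp: has_real_derivative_iff_has_vector_derivative intro: has_vector_derivative_at_within)
  moreover have "(LBINT x=s..t. g' x *\<^sub>R f (g x)) = (LBINT y=g s..g t. f y)"
    using assms(1) g f g'
    by (intro interval_integral_substitution_finite) (auto intro: has_field_derivative_at_within)
  ultimately show ?thesis by simp
qed

text \<open>The Pythagorean identity in the shape that componentwise expansion of inner products
  produces.\<close>

lemma inner_circle: "x * sin v * (y * sin v) + x * cos v * (y * cos v) = x * y" for x y v :: real
proof -
  have "x * sin v * (y * sin v) + x * cos v * (y * cos v) = x * y * ((sin v)\<^sup>2 + (cos v)\<^sup>2)"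
    unfolding power2_eq_square by (simp only: algebra_simps)
  then show ?thesis by simp
qed

section \<open>The surface of revolution: curvatures and derivatives of the profile
  functions\<close>

locale revolution_envelope =
  fixes r :: "real \<Rightarrow> real" and U :: "real set"
  assumes open_U: "open U"
    and smooth_r: "smooth_on U r"
    and r_pos: "u \<in> U \<Longrightarrow> 0 < r u"
    and r'_less: "u \<in> U \<Longrightarrow> \<bar>deriv r u\<bar> < 1"
    and W_nonzero: "u \<in> U \<Longrightarrow> 1 - (deriv r u)\<^sup>2 - r u * deriv (deriv r) u \<noteq> 0"
    and k1_less_k2: "u \<in> U \<Longrightarrow> rev_k1 r u < rev_k2 r u"
begin

abbreviation "p \<equiv> deriv r"
abbreviation "q \<equiv> deriv p"

text \<open>\<open>W\<close> is the derivative of the height \<open>u - r u * p u\<close> of the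
  surface point, and \<open>W / C\<close> is the speed along a meridian.\<close>

definition W :: "real \<Rightarrow> real" where "W u = 1 - (p u)\<^sup>2 - r u * q u"
definition C :: "real \<Rightarrow> real" where "C u = sqrt (1 - (p u)\<^sup>2)"

lemma p_square_less: "u \<in> U \<Longrightarrow> (p u)\<^sup>2 < 1"
  using r'_less by (simp add: abs_square_less_1)

lemma C_pos: "u \<in> U \<Longrightarrow> 0 < C u"
  by (simp add: C_def p_square_less)

lemma C_square: "u \<in> U \<Longrightarrow> (C u)\<^sup>2 = 1 - (p u)\<^sup>2"
  using p_square_less[of u] by (simp add: C_def)

text \<open>Over the common denominator \<open>r u * W u\<close> the numerator is
  \<open>- (r u * q u + W u)\<close>, and
  \<open>W u + r u * q u = 1 - (p u)\<^sup>2\<close>.\<close>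

lemma curvature_difference:
  assumes "u \<in> U"
  shows "rev_k1 r u - rev_k2 r u = - (C u)\<^sup>2 / (r u * W u)"
proof -
  have "W u \<noteq> 0" "r u \<noteq> 0"
    using W_nonzero[OF assms] r_pos[OF assms] by (auto simp: W_def)
  then show ?thesis
    unfolding rev_k1_def rev_k2_def C_square[OF assms] W_def[of u, symmetric]
    by (simp add: field_simps) (simp add: W_def algebra_simps)
qed

lemma W_pos:
  assumes "u \<in> U"
  shows "0 < W u"
proof (rule ccontr)
  assume "\<not> 0 < W u"
  then have "r u * W u \<le> 0"
    using r_pos[OF assms] by (simp add: mult_nonneg_nonpos)
  then have "0 \<le> - (C u)\<^sup>2 / (r u * W u)"
    by (simp add: divide_nonneg_nonpos)
  then show False
    using curvature_difference[OF assms] k1_less_k2[OF assms] by linarith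
qed

lemma cos_rev_beta: "u \<in> U \<Longrightarrow> cos (rev_beta r u) = C u"
  and sin_rev_beta: "u \<in> U \<Longrightarrow> sin (rev_beta r u) = p u"
  using r'_less[of u] by (auto simp: rev_beta_def C_def cos_arcsin abs_less_iff)

lemma rev_H_eq:
  "u \<in> U \<Longrightarrow> rev_H r u v = vector [r u * C u * cos v, r u * C u * sin v, u - r u * p u]"
  by (simp add: rev_H_def cos_rev_beta sin_rev_beta vec_eq_iff forall_3)

lemma DERIV_r: "u \<in> U \<Longrightarrow> (r has_real_derivative p u) (at u)"
  and DERIV_p: "u \<in> U \<Longrightarrow> (p has_real_derivative q u) (at u)"
  and DERIV_q: "u \<in> U \<Longrightarrow> (q has_real_derivative deriv q u) (at u)"
  and DERIV_q': "u \<in> U \<Longrightarrow> (deriv q has_real_derivative deriv (deriv q) u) (at u)"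
  using smooth_on_DERIV[OF smooth_r open_U, of u 0] smooth_on_DERIV[OF smooth_r open_U, of u 1]
    smooth_on_DERIV[OF smooth_r open_U, of u 2] smooth_on_DERIV[OF smooth_r open_U, of u 3]
  by (simp_all add: numeral_2_eq_2 numeral_3_eq_3)

lemma DERIV_C:
  assumes "u \<in> U"
  shows "(C has_real_derivative - (p u * q u / C u)) (at u)"
proof -
  have "((\<lambda>x. 1 - (p x)\<^sup>2) has_real_derivative - (2 * p u * q u)) (at u)"
    by (rule derivative_eq_intros DERIV_p[OF assms] refl)+ simp
  from DERIV_chain2[OF DERIV_real_sqrt this] p_square_less[OF assms] show ?thesis
    by (simp add: C_def[abs_def] field_simps)
qed

lemma DERIV_W:
  assumes "u \<in> U"
  shows "(W has_real_derivative - (3 * p u * q u + r u * deriv q u)) (at u)"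
  unfolding W_def[abs_def]
  by (rule derivative_eq_intros DERIV_r[OF assms] DERIV_p[OF assms] DERIV_q[OF assms] refl)+ simp

section \<open>Ridge points and their types\<close>

lemma ridge_function_eq: "ridge_function r u = deriv q u * (1 - (p u)\<^sup>2) + 3 * p u * (q u)\<^sup>2"
  by (simp add: ridge_function_def numeral_2_eq_2 numeral_3_eq_3)

text \<open>In the quotient rule for \<open>- q / W\<close> the two terms
  \<open>r u * q u * deriv q u\<close> cancel, and what remains of the numerator is the negative of
  the ridge function.\<close>

lemma DERIV_k1:
  assumes "u \<in> U"
  shows "(rev_k1 r has_real_derivative - ridge_function r u / (W u)\<^sup>2) (at u)"
proof -
  have "W u \<noteq> 0" using W_pos[OF assms] by simp
  have "((\<lambda>x. - q x / W x) has_real_derivative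
      (- deriv q u * W u - - q u * - (3 * p u * q u + r u * deriv q u)) / (W u * W u)) (at u)"
    by (intro DERIV_divide DERIV_minus DERIV_q DERIV_W assms \<open>W u \<noteq> 0\<close>)
  also have "- deriv q u * W u - - q u * - (3 * p u * q u + r u * deriv q u) = - ridge_function r u"
    unfolding ridge_function_eq W_def by (simp add: algebra_simps power2_eq_square)
  also have "(\<lambda>x. - q x / W x) = rev_k1 r"
    by (simp add: fun_eq_iff rev_k1_def W_def)
  finally show ?thesis by (simp add: power2_eq_square)
qed

lemma du_k1: "u \<in> U \<Longrightarrow> du (\<lambda>u v. rev_k1 r u) u v = - ridge_function r u / (W u)\<^sup>2"
  using DERIV_k1 by (simp add: du_def vector_derivative_at has_real_derivative_iff_has_vector_derivative)

lemma ridge_point_iff: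
  "u \<in> U \<Longrightarrow> ridge_point (\<lambda>u v. rev_k1 r u) u v \<longleftrightarrow> ridge_function r u = 0"
  using W_pos[of u] by (simp add: ridge_point_def du_k1)

text \<open>In the derivative of \<open>- ridge_function r / W\<^sup>2\<close> the term from the
  denominator carries the factor \<open>ridge_function r u\<close>, so at a ridge only the
  derivative of the numerator survives.\<close>

lemma du_du_k1_at_ridge:
  assumes "u \<in> U" "ridge_function r u = 0"
  shows "du (du (\<lambda>u v. rev_k1 r u)) u v = - deriv (ridge_function r) u / (W u)\<^sup>2"
proof -
  have "ridge_function r differentiable (at u)"
  proof -
    have "p differentiable (at u)" "q differentiable (at u)" "deriv q differentiable (at u)"
      using DERIV_p DERIV_q DERIV_q' assms(1) real_differentiable_def by blast+
    then show ?thesis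
      unfolding ridge_function_eq[abs_def] by (intro derivative_intros)
  qed
  then have R: "(ridge_function r has_real_derivative deriv (ridge_function r) u) (at u)"
    by (simp add: DERIV_deriv_iff_real_differentiable)
  have "((\<lambda>x. - ridge_function r x / (W x)\<^sup>2) has_real_derivative
      - deriv (ridge_function r) u / (W u)\<^sup>2) (at u)"
    by (rule derivative_eq_intros R DERIV_W assms(1) refl)+
      (use W_pos[OF assms(1)] assms(2) in \<open>simp_all add: power2_eq_square\<close>)
  \<comment> \<open>The formula for the first derivative of the curvature holds throughout the open
    set \<open>U\<close>, so it may be differentiated again.\<close>
  then have "((\<lambda>x. du (\<lambda>u v. rev_k1 r u) x v) has_real_derivative
      - deriv (ridge_function r) u / (W u)\<^sup>2) (at u)"
    by (rule has_field_derivative_transform_within_open[OF _ open_U assms(1)]) (simp add: du_k1)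
  then show ?thesis
    by (simp add: du_def[of "du _"] vector_derivative_at has_real_derivative_iff_has_vector_derivative)
qed

text \<open>The two minus signs are absorbed into \<open>rev_k2 r u - rev_k1 r u\<close>. The
  denominator is then positive, and the sign of \<open>sigma1\<close> is that of the derivative of
  the ridge function.\<close>

lemma sigma1_at_ridge:
  assumes "u \<in> U" "ridge_function r u = 0"
  shows "sigma1 (\<lambda>u v. rev_k1 r u) (\<lambda>u v. rev_k2 r u) u v
    = deriv (ridge_function r) u / ((W u)\<^sup>2 * (rev_k2 r u - rev_k1 r u))"
  using k1_less_k2[OF assms(1)] W_pos[OF assms(1)]
  unfolding sigma1_def du_du_k1_at_ridge[OF assms] by (simp add: field_simps)

lemma ridge_types:
  assumes "u \<in> U" "ridge_point (\<lambda>u v. rev_k1 r u) u v"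
  shows "deriv (ridge_function r) u < 0 \<Longrightarrow>
      zigzag_ridge_point (\<lambda>u v. rev_k1 r u) (\<lambda>u v. rev_k2 r u) u v"
    and "deriv (ridge_function r) u > 0 \<Longrightarrow>
      beak_to_beak_ridge_point (\<lambda>u v. rev_k1 r u) (\<lambda>u v. rev_k2 r u) u v"
  using assms k1_less_k2[of u] W_pos[of u] sigma1_at_ridge[of u v] ridge_point_iff[of u v]
  by (simp_all add: zigzag_ridge_point_def beak_to_beak_ridge_point_def divide_neg_pos)

section \<open>Distance to the axis, the integral in terms of \<open>C\<close> and \<open>W\<close>,
  and the first fundamental form\<close>

lemma infdist_rev_axis:
  assumes "u \<in> U"
  shows "infdist (rev_H r u v) rev_axis = r u * C u"
proof (rule antisym)
  \<comment> \<open>The orthogonal projection onto the axis, where the minimum is attained; any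
    other axis point adds the square of a height difference under the root.\<close>
  let ?y = "vector [0, 0, u - r u * p u] :: real^3"
  have h: "0 < r u * C u" using r_pos C_pos assms by simp
  have d: "norm (vector [r u * C u * cos v, r u * C u * sin v, z] :: real^3) = sqrt ((r u * C u)\<^sup>2 + z\<^sup>2)" for z
  proof -
    have "(r u * C u * cos v)\<^sup>2 + (r u * C u * sin v)\<^sup>2 = (r u * C u)\<^sup>2 * ((sin v)\<^sup>2 + (cos v)\<^sup>2)"
      by (simp only: power_mult_distrib algebra_simps)
    then show ?thesis by (simp add: norm_vec_def L2_set_def sum_3)
  qed
  have sub: "rev_H r u v - y = vector [r u * C u * cos v, r u * C u * sin v, u - r u * p u - y $ 3]"
    if "y \<in> rev_axis" for y
    using that by (simp add: rev_H_eq assms rev_axis_def vec_eq_iff forall_3)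
  have y: "?y \<in> rev_axis" by (simp add: rev_axis_def)
  show "infdist (rev_H r u v) rev_axis \<le> r u * C u"
    using infdist_le[OF y, of "rev_H r u v"] h by (simp add: dist_norm sub[OF y] d)
  have "r u * C u \<le> dist (rev_H r u v) y" if "y \<in> rev_axis" for y
    unfolding dist_norm sub[OF that] d by (rule real_le_rsqrt) simp
  then show "r u * C u \<le> infdist (rev_H r u v) rev_axis"
    using y by (subst infdist_notempty) (auto intro!: cINF_greatest)
qed

lemma darboux_integral_eq:
  assumes "u \<in> U"
  shows "darboux_integral r u \<alpha> = - ((C u * cos \<alpha>) ^ 3 / W u)"
  using r_pos[OF assms]
  by (simp add: darboux_integral_def cos_rev_beta assms curvature_difference
      power2_eq_square power3_eq_cube)

text \<open>The radial component follows from
  \<open>(r C)' = p (C\<^sup>2 - r q) / C = p W / C\<close>. The positive factor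
  \<open>W / C\<close> is split off so that the remaining vector has length one.\<close>

lemma du_rev_H:
  assumes "u \<in> U"
  shows "du (rev_H r) u v = (W u / C u) *\<^sub>R vector [p u * cos v, p u * sin v, C u]"
proof -
  have C: "C u \<noteq> 0" "W u = C u * C u - r u * q u"
    using C_pos[OF assms] C_square[OF assms] by (simp_all add: W_def power2_eq_square)
  have "((\<lambda>x. r x * C x) has_real_derivative p u * W u / C u) (at u)"
    by (rule derivative_eq_intros DERIV_r DERIV_C assms refl)+
      (use C(1) in \<open>simp add: C(2) field_simps\<close>)
  moreover have "((\<lambda>x. x - r x * p x) has_real_derivative W u) (at u)"
    by (rule derivative_eq_intros DERIV_r DERIV_p assms refl)+
      (simp add: W_def power2_eq_square)
  ultimately have "((\<lambda>x. vector [r x * C x * cos v, r x * C x * sin v, x - r x * p x] :: real^3)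
      has_vector_derivative vector [p u * W u / C u * cos v, p u * W u / C u * sin v, W u]) (at u)"
    by (intro has_vector_derivative_vector3 DERIV_cmult_right)
  then have "((\<lambda>x. rev_H r x v) has_vector_derivative
      vector [p u * W u / C u * cos v, p u * W u / C u * sin v, W u]) (at u)"
    by (rule has_vector_derivative_transform_within_open[OF _ open_U assms]) (simp add: rev_H_eq)
  then have "du (rev_H r) u v = vector [p u * W u / C u * cos v, p u * W u / C u * sin v, W u]"
    unfolding du_def by (rule vector_derivative_at)
  then show ?thesis using C by (simp add: vec_eq_iff forall_3)
qed

lemma dv_rev_H:
  assumes "u \<in> U"
  shows "dv (rev_H r) u v = (r u * C u) *\<^sub>R vector [- sin v, cos v, 0]"
proof -
  have "((\<lambda>x. rev_H r u x) has_vector_derivative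
      vector [- (r u * C u * sin v), r u * C u * cos v, 0]) (at v)"
    unfolding rev_H_eq[OF assms]
    by (rule has_vector_derivative_vector3; (rule derivative_eq_intros refl)+; simp)
  then have "dv (rev_H r) u v = vector [- (r u * C u * sin v), r u * C u * cos v, 0]"
    unfolding dv_def by (rule vector_derivative_at)
  then show ?thesis by (simp add: vec_eq_iff forall_3)
qed

lemma sqrt_form_E:
  assumes "u \<in> U"
  shows "sqrt (form_E (rev_H r) u v) = W u / C u"
proof -
  have "(vector [p u * cos v, p u * sin v, C u] :: real^3) \<bullet> vector [p u * cos v, p u * sin v, C u] = 1"
    using inner_circle[of "p u" v "p u"] C_square[OF assms]
    by (simp add: inner_vec_def sum_3 power2_eq_square)
  then have "form_E (rev_H r) u v = (W u / C u)\<^sup>2"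
    by (simp add: form_E_def du_rev_H assms power2_eq_square)
  then show ?thesis
    using W_pos[OF assms] C_pos[OF assms] by simp
qed

lemma sqrt_form_G:
  assumes "u \<in> U"
  shows "sqrt (form_G (rev_H r) u v) = r u * C u"
proof -
  have "(vector [- sin v, cos v, 0] :: real^3) \<bullet> vector [- sin v, cos v, 0] = 1"
    using inner_circle[of 1 v 1] by (simp add: inner_vec_def sum_3)
  then have "form_G (rev_H r) u v = (r u * C u)\<^sup>2"
    by (simp add: form_G_def dv_rev_H assms power2_eq_square)
  then show ?thesis
    using r_pos[OF assms] C_pos[OF assms] by simp
qed

end

section \<open>Unit speed curves on the surface and the first integral\<close>

locale unit_speed_curve = revolution_envelope +
  fixes J :: "real set" and u v \<alpha> :: "real \<Rightarrow> real"
  assumes open_J: "open J"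
    and u_in_U: "s \<in> J \<Longrightarrow> u s \<in> U"
    and arc_length: "arc_length_with_angle (rev_H r) J u v \<alpha>"
begin

lemma DERIV_u: "s \<in> J \<Longrightarrow> (u has_real_derivative C (u s) * cos (\<alpha> s) / W (u s)) (at s)"
  and DERIV_v: "s \<in> J \<Longrightarrow> (v has_real_derivative sin (\<alpha> s) / (r (u s) * C (u s))) (at s)"
  using arc_length u_in_U[of s]
  by (auto simp: arc_length_with_angle_def sqrt_form_E sqrt_form_G mult.commute)

text \<open>The equation enters only through the product of sine, cosine and
  \<open>\<alpha>'\<close>. There is no division by this product's trigonometric factors, so points
  where the curve touches a meridian or a parallel are included.\<close>

lemma DERIV_darboux_integral:
  assumes s: "s \<in> J" and \<alpha>': "(\<alpha> has_real_derivative \<alpha>') (at s)"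
    and ode: "3 * (rev_k1 r (u s) - rev_k2 r (u s)) * sin (\<alpha> s) * cos (\<alpha> s) * \<alpha>'
      = C (u s) / W (u s) * (- ridge_function r (u s) / (W (u s))\<^sup>2) * cos (\<alpha> s) ^ 3"
  shows "((\<lambda>s. darboux_integral r (u s) (\<alpha> s)) has_real_derivative 0) (at s)"
proof -
  have us: "u s \<in> U" by (rule u_in_U[OF s])
  define P Q Q' R \<rho> w c x y where "P = p (u s)" and "Q = q (u s)" and "Q' = deriv q (u s)"
    and "R = ridge_function r (u s)" and "\<rho> = r (u s)" and "w = W (u s)" and "c = C (u s)"
    and "x = cos (\<alpha> s)" and "y = sin (\<alpha> s)"
  note defs = this
  have pos: "\<rho> > 0" "w > 0" "c > 0"
    using r_pos[OF us] W_pos[OF us] C_pos[OF us] by (simp_all add: defs)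
  have c2: "c\<^sup>2 = 1 - P\<^sup>2" and w: "w = c\<^sup>2 - \<rho> * Q" and R: "R = Q' * c\<^sup>2 + 3 * P * Q\<^sup>2"
    using C_square[OF us] by (simp_all add: defs W_def ridge_function_eq)
  have key: "3 * P * Q * w + \<rho> * R = c\<^sup>2 * (3 * P * Q + \<rho> * Q')"
    unfolding w R by (simp add: algebra_simps power2_eq_square)
  have "3 * (- c\<^sup>2 / (\<rho> * w)) * y * x * \<alpha>' = c / w * (- R / w\<^sup>2) * x ^ 3"
    using ode by (simp add: curvature_difference us flip: defs)
  \<comment> \<open>The differential equation multiplied by
    \<open>- \<rho> * w ^ 3 / c\<close>.\<close>
  then have E: "3 * c * w\<^sup>2 * y * x * \<alpha>' = \<rho> * R * x ^ 3"
    using pos by (simp add: field_simps power2_eq_square)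
  have Cu: "((\<lambda>t. C (u t)) has_real_derivative - (P * Q * x / w)) (at s)"
    using DERIV_chain2[OF DERIV_C[OF us] DERIV_u[OF s]] pos by (simp add: mult.assoc flip: defs)
  have Wu: "((\<lambda>t. W (u t)) has_real_derivative - (3 * P * Q + \<rho> * Q') * (c * x / w)) (at s)"
    using DERIV_chain2[OF DERIV_W[OF us] DERIV_u[OF s]] by (simp flip: defs)
  have "((\<lambda>t. - ((C (u t) * cos (\<alpha> t)) ^ 3 / W (u t))) has_real_derivative
      - ((3 * (c * x)\<^sup>2 * (- (P * Q * x / w) * x - c * (y * \<alpha>')) * w
        - (c * x) ^ 3 * (- (3 * P * Q + \<rho> * Q') * (c * x / w))) / (w * w))) (at s)"
    by (rule derivative_eq_intros Cu Wu \<alpha>' refl)+ (use pos in \<open>simp_all add: algebra_simps flip: defs\<close>)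
  \<comment> \<open>The terms are grouped so that \<open>\<alpha>'\<close> occurs only in the
    left-hand side of \<open>E\<close>. By \<open>E\<close> and \<open>key\<close> both groups
    become \<open>c\<^sup>2 * x ^ 4 * \<rho> * R\<close>, and they cancel.\<close>
  also have "3 * (c * x)\<^sup>2 * (- (P * Q * x / w) * x - c * (y * \<alpha>')) * w
        - (c * x) ^ 3 * (- (3 * P * Q + \<rho> * Q') * (c * x / w))
      = (c\<^sup>2 * x ^ 4 * (c\<^sup>2 * (3 * P * Q + \<rho> * Q') - 3 * P * Q * w)
          - c\<^sup>2 * x * (3 * c * w\<^sup>2 * y * x * \<alpha>')) / w"
    using pos by (simp add: field_simps power2_eq_square power3_eq_cube power4_eq_xxxx)
  also have "\<dots> = 0"
    unfolding E key[symmetric] by (simp add: algebra_simps power3_eq_cube power4_eq_xxxx)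
  finally have D: "((\<lambda>t. - ((C (u t) * cos (\<alpha> t)) ^ 3 / W (u t))) has_real_derivative 0) (at s)"
    by simp
  show ?thesis
    by (rule has_field_derivative_transform_within_open[OF D open_J s])
      (simp add: darboux_integral_eq u_in_U)
qed

text \<open>The curvature \<open>k2\<close> does not depend on \<open>v\<close>, so the sine term of
  the differential equation drops out. A function with zero derivative on a connected open set is
  constant.\<close>

lemma darboux_integral_constant:
  assumes "connected J"
    and ode: "darboux_ode_solution (rev_H r) (\<lambda>u v. rev_k1 r u) (\<lambda>u v. rev_k2 r u) J u v \<alpha>"
  shows "(\<lambda>s. darboux_integral r (u s) (\<alpha> s)) constant_on J"
proof -
  have "((\<lambda>s. darboux_integral r (u s) (\<alpha> s)) has_real_derivative 0) (at s)" if s: "s \<in> J" for s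
  proof -
    have dv0: "dv (\<lambda>u v. rev_k2 r u) x y = 0" for x y
      by (simp add: dv_def)
    obtain \<alpha>' where "(\<alpha> has_real_derivative \<alpha>') (at s)"
      "3 * (rev_k1 r (u s) - rev_k2 r (u s)) * sin (\<alpha> s) * cos (\<alpha> s) * \<alpha>'
         = 1 / sqrt (form_E (rev_H r) (u s) (v s)) * du (\<lambda>u v. rev_k1 r u) (u s) (v s) * cos (\<alpha> s) ^ 3"
      using ode s unfolding darboux_ode_solution_def dv0 by auto
    then show ?thesis
      by (intro DERIV_darboux_integral s) (simp_all add: sqrt_form_E u_in_U[OF s] du_k1)
  qed
  then have "darboux_integral r (u s) (\<alpha> s) = darboux_integral r (u t) (\<alpha> t)"
    if "s \<in> J" "t \<in> J" for s t
      by (intro has_derivative_zero_unique_connected[OF open_J assms(1) _ that])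
        (auto simp: has_field_derivative_def lambda_zero)
  then show ?thesis
    unfolding constant_on_def by metis
qed

section \<open>The Darboux frame along the curve\<close>

definition e1 :: "real \<Rightarrow> real^3" where
  "e1 t = vector [p (u t) * cos (v t), p (u t) * sin (v t), C (u t)]"

definition e2 :: "real \<Rightarrow> real^3" where
  "e2 t = vector [- sin (v t), cos (v t), 0]"

definition n :: "real \<Rightarrow> real^3" where
  "n t = vector [- (C (u t) * cos (v t)), - (C (u t) * sin (v t)), p (u t)]"

abbreviation "k1 t \<equiv> rev_k1 r (u t)"
abbreviation "k2 t \<equiv> rev_k2 r (u t)"

text \<open>The geodesic curvature of the curve is \<open>\<alpha>' + \<omega>\<close>.\<close>

definition \<omega> :: "real \<Rightarrow> real" where
  "\<omega> t = p (u t) * sin (\<alpha> t) / (r (u t) * C (u t))"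

lemma orthonormal_frame:
  assumes "s \<in> J"
  shows "e1 s \<bullet> e1 s = 1" "e2 s \<bullet> e2 s = 1" "e1 s \<bullet> e2 s = 0" "e2 s \<bullet> e1 s = 0"
    "e1 s \<bullet> n s = 0" "e2 s \<bullet> n s = 0"
  using inner_circle[of "p (u s)" "v s" "p (u s)"] inner_circle[of 1 "v s" 1]
    inner_circle[of "p (u s)" "v s" "C (u s)"] C_square[OF u_in_U[OF assms]]
  by (simp_all add: e1_def e2_def n_def inner_vec_def sum_3 power2_eq_square algebra_simps)

text \<open>The equations are solved by undoing two rotations: the one with cosine \<open>c\<close>
  and sine \<open>P\<close> gives the radial component \<open>z\<close> and the height, the one by
  the angle \<open>v s\<close> then gives the horizontal components. This will show that a nonzero
  gradient orthogonal to the surface has a nonzero component along \<open>n\<close>.\<close>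

lemma frame_total:
  assumes "s \<in> J" and x: "x \<bullet> e1 s = 0" "x \<bullet> e2 s = 0" "x \<bullet> n s = 0"
  shows "x = 0"
proof -
  define P c a b z where "P = p (u s)" and "c = C (u s)" and "a = cos (v s)" and "b = sin (v s)"
    and "z = x $ 1 * a + x $ 2 * b"
  have c: "c * c + P * P = 1"
    using C_square[OF u_in_U[OF assms(1)]] by (simp add: c_def P_def power2_eq_square)
  have ab: "a * a + b * b = 1"
    using sin_cos_squared_add3[of "v s"] by (simp add: a_def b_def)
  have 1: "P * z + c * x $ 3 = 0" and 2: "x $ 2 * a - x $ 1 * b = 0" and 3: "P * x $ 3 - c * z = 0"
    using x by (simp_all add: e1_def e2_def n_def inner_vec_def sum_3 z_def algebra_simps
        flip: a_def b_def P_def c_def)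
  have "z = (c * c + P * P) * z" "x $ 3 = (c * c + P * P) * x $ 3"
    by (simp_all add: c)
  moreover have "(c * c + P * P) * z = P * (P * z + c * x $ 3) - c * (P * x $ 3 - c * z)"
    "(c * c + P * P) * x $ 3 = c * (P * z + c * x $ 3) + P * (P * x $ 3 - c * z)"
    by (simp_all add: algebra_simps)
  ultimately have z: "z = 0" "x $ 3 = 0"
    unfolding 1 3 by simp_all
  have "x $ 1 = (a * a + b * b) * x $ 1" "x $ 2 = (a * a + b * b) * x $ 2"
    by (simp_all add: ab)
  moreover have "(a * a + b * b) * x $ 1 = a * z - b * (x $ 2 * a - x $ 1 * b)"
    "(a * a + b * b) * x $ 2 = b * z + a * (x $ 2 * a - x $ 1 * b)"
    by (simp_all add: z_def algebra_simps)
  ultimately show "x = 0"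
    unfolding z 2 by (simp add: vec_eq_iff forall_3 z)
qed

text \<open>The normal terms are the formula of Rodrigues read along the curve. Meridians are
  geodesics, so \<open>e1\<close> turns towards \<open>e2\<close> only through the change of
  \<open>v\<close>, at the rate \<open>p\<close> times the derivative of \<open>v\<close>, which is
  \<open>\<omega>\<close>.\<close>

lemma darboux_frame:
  assumes s: "s \<in> J"
  shows "((\<lambda>t. rev_H r (u t) (v t)) has_vector_derivative
      cos (\<alpha> s) *\<^sub>R e1 s + sin (\<alpha> s) *\<^sub>R e2 s) (at s)"
    and "(e1 has_vector_derivative (k1 s * cos (\<alpha> s)) *\<^sub>R n s + \<omega> s *\<^sub>R e2 s) (at s)"
    and "(e2 has_vector_derivative (- \<omega> s) *\<^sub>R e1 s + (k2 s * sin (\<alpha> s)) *\<^sub>R n s) (at s)"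
    and "(n has_vector_derivative
      (- k1 s * cos (\<alpha> s)) *\<^sub>R e1 s - (k2 s * sin (\<alpha> s)) *\<^sub>R e2 s) (at s)"
proof -
  have us: "u s \<in> U" by (rule u_in_U[OF s])
  define P Q \<rho> w c x y where "P = p (u s)" and "Q = q (u s)"
    and "\<rho> = r (u s)" and "w = W (u s)" and "c = C (u s)"
    and "x = cos (\<alpha> s)" and "y = sin (\<alpha> s)"
  note defs = this
  have pos: "\<rho> > 0" "w > 0" "c > 0"
    using r_pos[OF us] W_pos[OF us] C_pos[OF us] by (simp_all add: defs)
  have c2: "c * c = 1 - P * P" and w: "w = c * c - \<rho> * Q"
    using C_square[OF us] by (simp_all add: defs W_def power2_eq_square)
  have k: "k1 s = - Q / w" "k2 s = 1 / \<rho>" "\<omega> s = P * y / (\<rho> * c)"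
    by (simp_all add: rev_k1_def rev_k2_def \<omega>_def W_def defs)
  have ru: "((\<lambda>t. r (u t)) has_real_derivative P * (c * x / w)) (at s)"
    and pu: "((\<lambda>t. p (u t)) has_real_derivative Q * (c * x / w)) (at s)"
    and Cu: "((\<lambda>t. C (u t)) has_real_derivative - (P * Q * x / w)) (at s)"
    using DERIV_chain2[OF DERIV_r[OF us] DERIV_u[OF s]] DERIV_chain2[OF DERIV_p[OF us] DERIV_u[OF s]]
      DERIV_chain2[OF DERIV_C[OF us] DERIV_u[OF s]] pos
    by (simp_all add: mult.assoc flip: defs)
  have u': "(u has_real_derivative c * x / w) (at s)"
    and v': "(v has_real_derivative y / (\<rho> * c)) (at s)"
    using DERIV_u[OF s] DERIV_v[OF s] by (simp_all flip: defs)
  \<comment> \<open>The distance to the axis changes only through the meridian component of the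
    velocity.\<close>
  have rC: "((\<lambda>t. r (u t) * C (u t)) has_real_derivative P * x) (at s)"
  proof -
    have "P * (c * x / w) * c + - (P * Q * x / w) * \<rho> = P * x * (c * c - \<rho> * Q) / w"
      by (simp add: algebra_simps diff_divide_distrib)
    also have "\<dots> = P * x"
      using pos by (simp flip: w)
    finally have "P * (c * x / w) * c + - (P * Q * x / w) * \<rho> = P * x" .
    with DERIV_mult[OF ru Cu, folded defs] show ?thesis by (simp only:)
  qed
  have z: "((\<lambda>t. u t - r (u t) * p (u t)) has_real_derivative c * x) (at s)"
  proof -
    have "c * x / w - (P * (c * x / w) * P + Q * (c * x / w) * \<rho>) = c * x * (1 - P * P - \<rho> * Q) / w"
      by (simp add: algebra_simps add_divide_distrib diff_divide_distrib)
    also have "\<dots> = c * x"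
      using pos by (simp flip: c2 w)
    finally have "c * x / w - (P * (c * x / w) * P + Q * (c * x / w) * \<rho>) = c * x" .
    with DERIV_diff[OF u' DERIV_mult[OF ru pu], folded defs] show ?thesis by (simp only:)
  qed
  have "((\<lambda>t. vector [r (u t) * C (u t) * cos (v t), r (u t) * C (u t) * sin (v t), u t - r (u t) * p (u t)] :: real^3)
      has_vector_derivative vector [x * P * cos (v s) - y * sin (v s), x * P * sin (v s) + y * cos (v s), c * x]) (at s)"
    by (intro has_vector_derivative_vector3 z;
        (rule derivative_eq_intros rC v' refl)+; use pos in \<open>simp add: field_simps flip: defs\<close>)
  then have "((\<lambda>t. rev_H r (u t) (v t)) has_vector_derivative
      vector [x * P * cos (v s) - y * sin (v s), x * P * sin (v s) + y * cos (v s), c * x]) (at s)"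
    by (rule has_vector_derivative_transform_within_open[OF _ open_J s]) (simp add: rev_H_eq u_in_U)
  also have "vector [x * P * cos (v s) - y * sin (v s), x * P * sin (v s) + y * cos (v s), c * x]
      = cos (\<alpha> s) *\<^sub>R e1 s + sin (\<alpha> s) *\<^sub>R e2 s"
    by (simp add: vec_eq_iff forall_3 e1_def e2_def flip: defs)
  finally show "((\<lambda>t. rev_H r (u t) (v t)) has_vector_derivative
      cos (\<alpha> s) *\<^sub>R e1 s + sin (\<alpha> s) *\<^sub>R e2 s) (at s)" .
  have "(e1 has_vector_derivative vector
      [Q * (c * x / w) * cos (v s) - P * sin (v s) * (y / (\<rho> * c)),
       Q * (c * x / w) * sin (v s) + P * cos (v s) * (y / (\<rho> * c)), - (P * Q * x / w)]) (at s)"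
    unfolding e1_def[abs_def]
    by (intro has_vector_derivative_vector3 Cu;
        (rule derivative_eq_intros pu v' refl)+; simp flip: defs)
  also have "vector
      [Q * (c * x / w) * cos (v s) - P * sin (v s) * (y / (\<rho> * c)),
       Q * (c * x / w) * sin (v s) + P * cos (v s) * (y / (\<rho> * c)), - (P * Q * x / w)]
      = (k1 s * cos (\<alpha> s)) *\<^sub>R n s + \<omega> s *\<^sub>R e2 s"
    by (simp add: vec_eq_iff forall_3 e2_def n_def k mult_ac flip: defs)
  finally show "(e1 has_vector_derivative (k1 s * cos (\<alpha> s)) *\<^sub>R n s + \<omega> s *\<^sub>R e2 s) (at s)" .
  have "(e2 has_vector_derivative vector
      [- (cos (v s) * (y / (\<rho> * c))), - (sin (v s) * (y / (\<rho> * c))), 0]) (at s)"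
    unfolding e2_def[abs_def]
    by (intro has_vector_derivative_vector3;
        (rule derivative_eq_intros v' refl)+; simp)
  also have "vector [- (cos (v s) * (y / (\<rho> * c))), - (sin (v s) * (y / (\<rho> * c))), 0]
      = (- \<omega> s) *\<^sub>R e1 s + (k2 s * sin (\<alpha> s)) *\<^sub>R n s"
  proof -
    \<comment> \<open>The derivative of \<open>e2\<close> is a multiple of the horizontal radial
      unit vector, which equals \<open>P\<close> times \<open>e1\<close> minus \<open>c\<close>
      times \<open>n\<close>; splitting 1 as \<open>P * P + c * c\<close> makes this decomposition
      visible.\<close>
    have key: "t * (y / (\<rho> * c)) = P * y * (P * t) / (\<rho> * c) + y * (c * t) / \<rho>" for t
    proof -
      have "P * y * (P * t) / (\<rho> * c) + y * (c * t) / \<rho> = (P * P + c * c) * t * y / (\<rho> * c)"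
        using pos by (simp add: field_simps)
      then show ?thesis by (simp add: c2)
    qed
    show ?thesis
      using key[of "cos (v s)"] key[of "sin (v s)"] pos
      by (simp add: vec_eq_iff forall_3 e1_def n_def k flip: defs)
  qed
  finally show "(e2 has_vector_derivative (- \<omega> s) *\<^sub>R e1 s + (k2 s * sin (\<alpha> s)) *\<^sub>R n s) (at s)" .
  have "(n has_vector_derivative vector
      [P * Q * x / w * cos (v s) + c * sin (v s) * (y / (\<rho> * c)),
       P * Q * x / w * sin (v s) - c * cos (v s) * (y / (\<rho> * c)), Q * (c * x / w)]) (at s)"
    unfolding n_def[abs_def]
    by (intro has_vector_derivative_vector3 pu;
        (rule derivative_eq_intros Cu v' refl)+; simp flip: defs)
  also have "vector
      [P * Q * x / w * cos (v s) + c * sin (v s) * (y / (\<rho> * c)),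
       P * Q * x / w * sin (v s) - c * cos (v s) * (y / (\<rho> * c)), Q * (c * x / w)]
      = (- k1 s * cos (\<alpha> s)) *\<^sub>R e1 s - (k2 s * sin (\<alpha> s)) *\<^sub>R e2 s"
    using pos by (simp add: vec_eq_iff forall_3 e1_def e2_def k mult_ac flip: defs)
  finally show "(n has_vector_derivative
      (- k1 s * cos (\<alpha> s)) *\<^sub>R e1 s - (k2 s * sin (\<alpha> s)) *\<^sub>R e2 s) (at s)" .
qed

section \<open>Contact with spheres and the differential equation of Darboux curves\<close>

lemma smooth_angle_DERIV:
  assumes "smooth_on J \<alpha>" "s \<in> J"
  shows "(\<alpha> has_real_derivative deriv \<alpha> s) (at s)"
    and "(deriv \<alpha> has_real_derivative deriv (deriv \<alpha>) s) (at s)"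
  using smooth_on_DERIV[OF assms(1) open_J assms(2), of 0] smooth_on_DERIV[OF assms(1) open_J assms(2), of 1]
  by simp_all

text \<open>Here \<open>g\<close> is the gradient of the sphere's equation along the curve. At
  \<open>s\<close> it is normal to the surface, so of the third derivative only multiples of
  \<open>g s \<bullet> n s\<close> survive: one from the derivative of the normal curvature, and one
  from the geodesic curvature times the geodesic torsion.\<close>

lemma third_derivative_of_contact_function:
  fixes a d :: real and b :: "real^3"
  defines "g \<equiv> \<lambda>t. (2 * a) *\<^sub>R rev_H r (u t) (v t) + b"
    and "f \<equiv> \<lambda>t. a * (rev_H r (u t) (v t) \<bullet> rev_H r (u t) (v t)) + b \<bullet> rev_H r (u t) (v t) + d"
  assumes smooth: "smooth_on J \<alpha>" and s: "s \<in> J" and tangent: "g s \<bullet> e1 s = 0" "g s \<bullet> e2 s = 0"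
    and K': "((\<lambda>t. k1 t * (cos (\<alpha> t))\<^sup>2 + k2 t * (sin (\<alpha> t))\<^sup>2) has_real_derivative K') (at s)"
  shows "(deriv ^^ 3) f s
    = (K' + (deriv \<alpha> s + \<omega> s) * sin (\<alpha> s) * cos (\<alpha> s) * (k2 s - k1 s)) * (g s \<bullet> n s)"
proof -
  note \<alpha>' = smooth_angle_DERIV[OF smooth]
  \<comment> \<open>\<open>A\<close> is the geodesic and \<open>K\<close> the normal curvature;
    \<open>f1\<close> and \<open>f2\<close> are the first two derivatives of
    \<open>f\<close>.\<close>
  define A where "A t = deriv \<alpha> t + \<omega> t" for t
  define K where "K t = k1 t * (cos (\<alpha> t))\<^sup>2 + k2 t * (sin (\<alpha> t))\<^sup>2" for t
  define f1 where "f1 t = cos (\<alpha> t) * (g t \<bullet> e1 t) + sin (\<alpha> t) * (g t \<bullet> e2 t)" for t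
  define f2 where "f2 t = 2 * a + A t * (cos (\<alpha> t) * (g t \<bullet> e2 t) - sin (\<alpha> t) * (g t \<bullet> e1 t))
    + K t * (g t \<bullet> n t)" for t
  have g: "(g has_vector_derivative (2 * a) *\<^sub>R (cos (\<alpha> t) *\<^sub>R e1 t + sin (\<alpha> t) *\<^sub>R e2 t)) (at t)"
    if "t \<in> J" for t
    unfolding g_def
    using has_vector_derivative_add[OF has_vector_derivative_scaleR[OF DERIV_const darboux_frame(1)[OF that]]
        has_vector_derivative_const[of b]] by simp
  note product = bounded_bilinear.has_vector_derivative[OF bounded_bilinear_inner]
  have g1: "((\<lambda>t. g t \<bullet> e1 t) has_real_derivative
      2 * a * cos (\<alpha> t) + k1 t * cos (\<alpha> t) * (g t \<bullet> n t) + \<omega> t * (g t \<bullet> e2 t)) (at t)"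
    and g2: "((\<lambda>t. g t \<bullet> e2 t) has_real_derivative
      2 * a * sin (\<alpha> t) - \<omega> t * (g t \<bullet> e1 t) + k2 t * sin (\<alpha> t) * (g t \<bullet> n t)) (at t)"
    and g3: "((\<lambda>t. g t \<bullet> n t) has_real_derivative
      - (k1 t * cos (\<alpha> t) * (g t \<bullet> e1 t)) - k2 t * sin (\<alpha> t) * (g t \<bullet> e2 t)) (at t)"
    if "t \<in> J" for t
    using product[OF g[OF that] darboux_frame(2)[OF that]]
      product[OF g[OF that] darboux_frame(3)[OF that]]
      product[OF g[OF that] darboux_frame(4)[OF that]]
    by (simp_all add: has_real_derivative_iff_has_vector_derivative inner_simps
        orthonormal_frame[OF that] algebra_simps)
  have f: "(f has_real_derivative f1 t) (at t)" if "t \<in> J" for t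
  proof -
    note H = darboux_frame(1)[OF that]
    have "((\<lambda>t. b \<bullet> rev_H r (u t) (v t)) has_real_derivative
        b \<bullet> (cos (\<alpha> t) *\<^sub>R e1 t + sin (\<alpha> t) *\<^sub>R e2 t)) (at t)"
      using product[OF has_vector_derivative_const[of b] H]
      by (simp add: has_real_derivative_iff_has_vector_derivative)
    moreover note product[OF H H, folded has_real_derivative_iff_has_vector_derivative]
    ultimately show ?thesis
      unfolding f_def
      apply -
      apply (rule derivative_eq_intros refl | assumption)+
      apply (simp add: f1_def g_def inner_simps inner_commute algebra_simps)
      done
  qed
  have f1: "(f1 has_real_derivative f2 t) (at t)" if "t \<in> J" for t
  proof -
    have "(f1 has_real_derivative
        cos (\<alpha> t) * (2 * a * cos (\<alpha> t)) + sin (\<alpha> t) * (2 * a * sin (\<alpha> t))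
        + A t * (cos (\<alpha> t) * (g t \<bullet> e2 t) - sin (\<alpha> t) * (g t \<bullet> e1 t)) + K t * (g t \<bullet> n t)) (at t)"
      unfolding f1_def[abs_def]
      by (rule derivative_eq_intros g1 g2 \<alpha>' that refl)+
        (simp add: A_def K_def algebra_simps power2_eq_square)
    also have "cos (\<alpha> t) * (2 * a * cos (\<alpha> t)) + sin (\<alpha> t) * (2 * a * sin (\<alpha> t))
        = 2 * a * ((sin (\<alpha> t))\<^sup>2 + (cos (\<alpha> t))\<^sup>2)"
      by (simp only: algebra_simps power2_eq_square)
    finally show ?thesis by (simp add: f2_def)
  qed
  \<comment> \<open>Differentiability is enough: in the derivative of \<open>f2\<close> at
    \<open>s\<close> the derivative of \<open>A\<close> is multiplied by a tangential component of
    \<open>g s\<close>, which is zero.\<close>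
  have A: "(A has_real_derivative deriv A s) (at s)"
  proof -
    have us: "u s \<in> U" by (rule u_in_U[OF s])
    have "(\<lambda>t. r (u t)) differentiable (at s)" "(\<lambda>t. p (u t)) differentiable (at s)"
      "(\<lambda>t. C (u t)) differentiable (at s)" "(\<lambda>t. sin (\<alpha> t)) differentiable (at s)"
      "deriv \<alpha> differentiable (at s)"
      using DERIV_chain2[OF DERIV_r[OF us] DERIV_u[OF s]] DERIV_chain2[OF DERIV_p[OF us] DERIV_u[OF s]]
        DERIV_chain2[OF DERIV_C[OF us] DERIV_u[OF s]] DERIV_chain2[OF DERIV_sin \<alpha>'(1)[OF s]] \<alpha>'(2)[OF s]
      by (auto simp: real_differentiable_def)
    moreover have "r (u s) * C (u s) \<noteq> 0"
      using r_pos[OF us] C_pos[OF us] by simp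
    ultimately have "A differentiable (at s)"
      unfolding A_def[abs_def] \<omega>_def by (intro derivative_intros)
    then show ?thesis by (simp add: DERIV_deriv_iff_real_differentiable)
  qed
  have "(f2 has_real_derivative (K' + A s * sin (\<alpha> s) * cos (\<alpha> s) * (k2 s - k1 s)) * (g s \<bullet> n s)) (at s)"
    unfolding f2_def[abs_def]
    by (rule derivative_eq_intros A K'[folded K_def[abs_def]] g1 g2 g3 \<alpha>' s refl)+
      (simp add: tangent algebra_simps)
  \<comment> \<open>The formulas hold on all of the open set \<open>J\<close>, so the iterated
    \<open>deriv\<close> can be replaced near \<open>s\<close>.\<close>
  moreover have "deriv f t = f1 t" if "t \<in> J" for t
    using f[OF that] by (rule DERIV_imp_deriv)
  moreover have "deriv (deriv f) t = f2 t" if "t \<in> J" for t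
    by (rule DERIV_imp_deriv, rule has_field_derivative_transform_within_open[OF f1 open_J])
      (use that calculation(2) in auto)
  ultimately have "(deriv (deriv f) has_real_derivative
      (K' + A s * sin (\<alpha> s) * cos (\<alpha> s) * (k2 s - k1 s)) * (g s \<bullet> n s)) (at s)"
    by - (rule has_field_derivative_transform_within_open[OF _ open_J s], auto)
  then show ?thesis
    by (simp add: numeral_3_eq_3 DERIV_imp_deriv A_def)
qed

text \<open>The factor 3 has two sources: differentiating the squares in the normal curvature
  contributes twice the term in \<open>deriv \<alpha> s\<close>, and the geodesic curvature
  contributes it once more.\<close>

lemma darboux_curve_ode:
  assumes smooth: "smooth_on J \<alpha>" and darboux: "darboux_curve_on (rev_H r) J u v"
  shows "darboux_ode_solution (rev_H r) (\<lambda>u v. rev_k1 r u) (\<lambda>u v. rev_k2 r u) J u v \<alpha>"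
proof -
  have "3 * (k1 s - k2 s) * sin (\<alpha> s) * cos (\<alpha> s) * deriv \<alpha> s
      = C (u s) / W (u s) * (- ridge_function r (u s) / (W (u s))\<^sup>2) * cos (\<alpha> s) ^ 3"
    if s: "s \<in> J" for s
  proof -
    have us: "u s \<in> U" by (rule u_in_U[OF s])
    define P R \<rho> w c x y where "P = p (u s)" and "R = ridge_function r (u s)"
      and "\<rho> = r (u s)" and "w = W (u s)" and "c = C (u s)"
      and "x = cos (\<alpha> s)" and "y = sin (\<alpha> s)"
    note defs = this
    have pos: "\<rho> > 0" "w > 0" "c > 0"
      using r_pos[OF us] W_pos[OF us] C_pos[OF us] by (simp_all add: defs)
    note \<alpha>' = smooth_angle_DERIV[OF smooth s]
    obtain a b d where osc: "osculating_sphere_at (\<lambda>t. rev_H r (u t) (v t)) s a b d"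
      and tu: "((2 * a) *\<^sub>R rev_H r (u s) (v s) + b) \<bullet> du (rev_H r) (u s) (v s) = 0"
      and tv: "((2 * a) *\<^sub>R rev_H r (u s) (v s) + b) \<bullet> dv (rev_H r) (u s) (v s) = 0"
      using darboux s unfolding darboux_curve_on_def by blast
    let ?g = "(2 * a) *\<^sub>R rev_H r (u s) (v s) + b"
    have g: "?g \<bullet> e1 s = 0" "?g \<bullet> e2 s = 0"
      using tu tv pos by (simp_all add: du_rev_H dv_rev_H us e1_def e2_def defs)
    \<comment> \<open>The gradient does not vanish and its tangential components do, so its normal
      component can be divided out.\<close>
    have "?g \<noteq> 0"
      using osc by (simp add: osculating_sphere_at_def)
    then have gn: "?g \<bullet> n s \<noteq> 0"
      using frame_total[OF s g] by blast
    have k1': "(k1 has_real_derivative - R / w\<^sup>2 * (c * x / w)) (at s)"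
      using DERIV_chain2[OF DERIV_k1[OF us] DERIV_u[OF s]] by (simp flip: defs)
    have ru: "((\<lambda>t. r (u t)) has_real_derivative P * (c * x / w)) (at s)"
      using DERIV_chain2[OF DERIV_r[OF us] DERIV_u[OF s]] by (simp flip: defs)
    have k2': "(k2 has_real_derivative - P * (c * x / w) / \<rho>\<^sup>2) (at s)"
      unfolding rev_k2_def
      by (rule derivative_eq_intros ru refl)+ (use pos in \<open>simp_all add: power2_eq_square flip: defs\<close>)
    have K': "((\<lambda>t. k1 t * (cos (\<alpha> t))\<^sup>2 + k2 t * (sin (\<alpha> t))\<^sup>2) has_real_derivative
        - R / w\<^sup>2 * (c * x / w) * x\<^sup>2 - P * (c * x / w) / \<rho>\<^sup>2 * y\<^sup>2
          + 2 * (k2 s - k1 s) * y * x * deriv \<alpha> s) (at s)"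
      by (rule derivative_eq_intros k1' k2' \<alpha>' refl)+ (simp add: algebra_simps flip: defs)
    have "(deriv ^^ 3) (\<lambda>t. a * (rev_H r (u t) (v t) \<bullet> rev_H r (u t) (v t)) + b \<bullet> rev_H r (u t) (v t) + d) s = 0"
      using osc by (simp add: osculating_sphere_at_def)
    then have "- R / w\<^sup>2 * (c * x / w) * x\<^sup>2 - P * (c * x / w) / \<rho>\<^sup>2 * y\<^sup>2
        + 2 * (k2 s - k1 s) * y * x * deriv \<alpha> s + (deriv \<alpha> s + \<omega> s) * y * x * (k2 s - k1 s) = 0"
      using third_derivative_of_contact_function[OF smooth s g K', of d] gn by (simp add: defs)
    \<comment> \<open>The Codazzi equation: the change of \<open>k2\<close> along meridians balances
      the part \<open>\<omega>\<close> of the geodesic curvature.\<close>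
    moreover have "\<omega> s * y * x * (k2 s - k1 s) = P * (c * x / w) / \<rho>\<^sup>2 * y\<^sup>2"
    proof -
      have k: "k2 s - k1 s = c\<^sup>2 / (\<rho> * w)"
        using curvature_difference[OF us] by (simp flip: defs)
      show ?thesis
        unfolding k using pos by (simp add: \<omega>_def field_simps power2_eq_square flip: defs)
    qed
    ultimately have "3 * (k1 s - k2 s) * y * x * deriv \<alpha> s = - R / w\<^sup>2 * (c * x / w) * x\<^sup>2"
      by (simp add: algebra_simps)
    then show ?thesis
      by (simp add: power2_eq_square power3_eq_cube mult.commute flip: defs)
  qed
  moreover have "dv (\<lambda>u v. rev_k2 r u) x y = 0" for x y
    by (simp add: dv_def)
  ultimately show ?thesis
    using arc_length smooth_angle_DERIV(1)[OF smooth]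
    by (auto simp: darboux_ode_solution_def sqrt_form_E u_in_U du_k1 intro!: exI[of _ "deriv \<alpha> s" for s])
qed

section \<open>Integration by quadratures on a level of the integral\<close>

lemma level_cos_eq:
  assumes "s \<in> J" "darboux_integral r (u s) (\<alpha> s) = c"
  shows "level_cos r c (u s) = cos (\<alpha> s)"
proof -
  have us: "u s \<in> U" by (rule u_in_U[OF assms(1)])
  have "c = rev_h r (u s) * (k1 s - k2 s) * cos (\<alpha> s) ^ 3"
    using assms(2) by (simp add: darboux_integral_def rev_h_def infdist_rev_axis us cos_rev_beta)
  moreover have "rev_h r (u s) * (k1 s - k2 s) \<noteq> 0"
    using r_pos[OF us] C_pos[OF us] k1_less_k2[OF us] by (simp add: rev_h_def infdist_rev_axis us)
  ultimately have "level_cos r c (u s) = root 3 (cos (\<alpha> s) ^ 3)"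
    unfolding level_cos_def by (metis nonzero_mult_div_cancel_left)
  also have "\<dots> = cos (\<alpha> s)"
    by (rule odd_real_root_power_cancel) simp
  finally show ?thesis .
qed

text \<open>Arc length and a constant value of the integral suffice. If \<open>c = 0\<close>, the
  cosine vanishes and the curve stays on a parallel; otherwise the cosine never vanishes, and
  \<open>u\<close> can replace arc length as variable of integration.\<close>

lemma quadratures:
  assumes "connected J"
    and cont: "continuous_on J \<alpha>"
    and level: "\<And>s. s \<in> J \<Longrightarrow> darboux_integral r (u s) (\<alpha> s) = c"
  shows "given_by_quadratures r c J u v \<alpha>"
proof -
  let ?conclusion = "\<lambda>s t \<epsilon>. if c = 0 then
        u t = u s \<and> v t - v s = \<epsilon> * (t - s) / sqrt (form_G (rev_H r) (u s) 0)
      else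
        v t - v s = (LBINT x=u s..u t. sqrt (form_E (rev_H r) x 0 / form_G (rev_H r) x 0)
                       * (\<epsilon> * sqrt (1 - (level_cos r c x)\<^sup>2) / level_cos r c x)) \<and>
        t - s = (LBINT x=u s..u t. sqrt (form_E (rev_H r) x 0) / level_cos r c x)"
  have forward: "?conclusion s t \<epsilon>"
    if st: "s \<in> J" "t \<in> J" "s < t" and \<epsilon>: "\<epsilon> \<in> {-1, 1}"
      and sign: "\<And>x. x \<in> {s..t} \<Longrightarrow> 0 \<le> \<epsilon> * sin (\<alpha> x)" for s t \<epsilon>
  proof -
    have sub: "{s..t} \<subseteq> J"
      using connected_contains_Icc[OF assms(1)] st by blast
    have D: "x \<in> J" "u x \<in> U" if "s \<le> x" "x \<le> t" for x
      using sub u_in_U that by auto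
    \<comment> \<open>The cosine gives the sine up to sign, and the sign condition on the arc
      selects \<open>\<epsilon>\<close>.\<close>
    have sin_eq: "sin (\<alpha> x) = \<epsilon> * sqrt (1 - (cos (\<alpha> x))\<^sup>2)" if "s \<le> x" "x \<le> t" for x
    proof -
      have "sqrt (1 - (cos (\<alpha> x))\<^sup>2) = \<bar>sin (\<alpha> x)\<bar>"
        by (simp add: sin_squared_eq[symmetric])
      then show ?thesis using sign[of x] \<epsilon> that by auto
    qed
    show ?thesis
    proof (cases "c = 0")
      case True
      have cos0: "cos (\<alpha> x) = 0" if "s \<le> x" "x \<le> t" for x
        using level[of x] D[OF that] C_pos[of "u x"] W_pos[of "u x"] True
        by (auto simp: darboux_integral_eq)
      have u': "(u has_real_derivative 0) (at x)" if "s \<le> x" "x \<le> t" for x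
        using DERIV_u[OF D(1)[OF that]] by (simp add: cos0 that)
      have u: "u x = u s" if "s \<le> x" "x \<le> t" for x
        using u' that
        by (intro DERIV_isconst2[OF \<open>s < t\<close>] DERIV_atLeastAtMost_imp_continuous_on) auto
      \<comment> \<open>The constant speed of \<open>v\<close> on a parallel, where the sine equals
        \<open>\<epsilon>\<close>.\<close>
      define k where "k = \<epsilon> / (r (u s) * C (u s))"
      have v': "((\<lambda>x. v x - k * x) has_real_derivative 0) (at x)" if "s \<le> x" "x \<le> t" for x
      proof -
        have "(v has_real_derivative k) (at x)"
          using DERIV_v[OF D(1)[OF that]] by (simp add: k_def u sin_eq cos0 that)
        then show ?thesis by (auto intro!: derivative_eq_intros)
      qed
      have "v t - k * t = v s - k * s"
        using v' \<open>s < t\<close>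
        by (intro DERIV_isconst_end DERIV_atLeastAtMost_imp_continuous_on) auto
      then show ?thesis
        using True u[of t] D(2)[of s] \<open>s < t\<close> by (simp add: sqrt_form_G k_def algebra_simps diff_divide_distrib)
    next
      case False
      have L: "level_cos r c (u x) = cos (\<alpha> x)" if "s \<le> x" "x \<le> t" for x
        by (rule level_cos_eq[OF D(1)[OF that] level[OF D(1)[OF that]]])
      \<comment> \<open>Hence neither integrand has a pole on the range of \<open>u\<close>.\<close>
      have cos: "cos (\<alpha> x) \<noteq> 0" if "s \<le> x" "x \<le> t" for x
        using level[of x] D[OF that] False by (auto simp: darboux_integral_eq)
      have image: "u ` {s..t} \<subseteq> U"
        using D(2) by auto
      have "continuous_on U r" "continuous_on U C" "continuous_on U W" "continuous_on U (rev_k1 r)"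
        by (auto intro!: continuous_at_imp_continuous_on DERIV_isCont dest: DERIV_r DERIV_C DERIV_W DERIV_k1)
      then have on_image: "continuous_on (u ` {s..t}) r" "continuous_on (u ` {s..t}) C"
        "continuous_on (u ` {s..t}) W" "continuous_on (u ` {s..t}) (rev_k1 r)"
        using image continuous_on_subset by blast+
      have nonzero: "r x \<noteq> 0" "C x \<noteq> 0" "W x \<noteq> 0" "rev_k1 r x - 1 / r x \<noteq> 0" if "x \<in> u ` {s..t}" for x
        using r_pos[of x] C_pos[of x] W_pos[of x] k1_less_k2[of x] that image by (auto simp: rev_k2_def)
      \<comment> \<open>Continuity is shown with the closed form \<open>r x * C x\<close> of the
        distance to the axis and then transferred to \<open>level_cos\<close>.\<close>
      have "continuous_on (u ` {s..t}) (\<lambda>x. root 3 (c / (r x * C x * (rev_k1 r x - 1 / r x))))"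
        by (intro continuous_intros on_image) (use nonzero in auto)
      then have L_cont: "continuous_on (u ` {s..t}) (level_cos r c)"
        by (rule continuous_on_eq)
          (use image in \<open>auto simp: level_cos_def rev_h_def rev_k2_def infdist_rev_axis\<close>)
      have L_nonzero: "level_cos r c x \<noteq> 0" if "x \<in> u ` {s..t}" for x
        using that L cos by auto
      have E_cont: "continuous_on (u ` {s..t}) (\<lambda>x. W x / C x)"
        and EG_cont: "continuous_on (u ` {s..t}) (\<lambda>x. (W x / C x) / (r x * C x))"
        by (intro continuous_intros on_image; use nonzero in auto)+
      have "continuous_on {s..t} \<alpha>"
        using cont sub by (rule continuous_on_subset)
      moreover have "continuous_on {s..t} u"
        using DERIV_u D(1) by (blast intro: DERIV_atLeastAtMost_imp_continuous_on)
      ultimately have "continuous_on {s..t} (\<lambda>x. C (u x) * cos (\<alpha> x) / W (u x))"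
        using nonzero by (intro continuous_intros continuous_on_compose2[OF on_image(2)]
          continuous_on_compose2[OF on_image(3)]) auto
      note substitution = interval_integral_along_path[OF less_imp_le[OF \<open>s < t\<close>] DERIV_u[OF D(1)] this]
      have "(LBINT x=u s..u t. sqrt (form_E (rev_H r) x 0 / form_G (rev_H r) x 0)
          * (\<epsilon> * sqrt (1 - (level_cos r c x)\<^sup>2) / level_cos r c x)) = v t - v s"
      proof (rule substitution)
        have "continuous_on (u ` {s..t}) (\<lambda>x. W x / C x / (r x * C x)
            * (\<epsilon> * sqrt (1 - (level_cos r c x)\<^sup>2) / level_cos r c x))"
          by (intro continuous_intros EG_cont L_cont) (use L_nonzero in auto)
        then show "continuous_on (u ` {s..t}) (\<lambda>x. sqrt (form_E (rev_H r) x 0 / form_G (rev_H r) x 0)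
            * (\<epsilon> * sqrt (1 - (level_cos r c x)\<^sup>2) / level_cos r c x))"
          by (rule continuous_on_eq)
            (use image in \<open>auto simp: real_sqrt_divide sqrt_form_E sqrt_form_G\<close>)
        fix x assume x: "s \<le> x" "x \<le> t"
        note ux = D[OF x]
        \<comment> \<open>The chain rule \<open>v' = u' * (dv/du)\<close>, where
          \<open>dv/du\<close> is \<open>sqrt (E / G)\<close> times the tangent of the
          angle.\<close>
        have "sin (\<alpha> x) / (r (u x) * C (u x)) = C (u x) * cos (\<alpha> x) / W (u x)
            * (W (u x) / C (u x) / (r (u x) * C (u x)) * (sin (\<alpha> x) / cos (\<alpha> x)))"
          using C_pos[OF ux(2)] W_pos[OF ux(2)] cos[OF x] by simp
        then show "(v has_real_derivative C (u x) * cos (\<alpha> x) / W (u x)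
            * (sqrt (form_E (rev_H r) (u x) 0 / form_G (rev_H r) (u x) 0)
              * (\<epsilon> * sqrt (1 - (level_cos r c (u x))\<^sup>2) / level_cos r c (u x)))) (at x)"
          using DERIV_v[OF ux(1)]
          by (simp only: real_sqrt_divide sqrt_form_E sqrt_form_G ux L[OF x] flip: sin_eq[OF x])
      qed
      moreover have "(LBINT x=u s..u t. sqrt (form_E (rev_H r) x 0) / level_cos r c x) = t - s"
      proof (rule substitution)
        have "continuous_on (u ` {s..t}) (\<lambda>x. W x / C x / level_cos r c x)"
          by (intro continuous_intros E_cont L_cont) (use L_nonzero in auto)
        then show "continuous_on (u ` {s..t}) (\<lambda>x. sqrt (form_E (rev_H r) x 0) / level_cos r c x)"
          by (rule continuous_on_eq) (use image in \<open>auto simp: sqrt_form_E\<close>)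
        fix x assume x: "s \<le> x" "x \<le> t"
        note ux = D[OF x]
        show "((\<lambda>x. x) has_real_derivative C (u x) * cos (\<alpha> x) / W (u x)
            * (sqrt (form_E (rev_H r) (u x) 0) / level_cos r c (u x))) (at x)"
          using C_pos[OF ux(2)] W_pos[OF ux(2)] cos[OF x] by (simp add: sqrt_form_E ux L x)
      qed
      ultimately show ?thesis using False by simp
    qed
  qed
  have "?conclusion s t \<epsilon>"
    if st: "s \<in> J" "t \<in> J" and \<epsilon>: "\<epsilon> \<in> {-1, 1}"
      and sign: "\<And>x. x \<in> closed_segment s t \<Longrightarrow> 0 \<le> \<epsilon> * sin (\<alpha> x)" for s t \<epsilon>
  proof (cases s t rule: linorder_cases)
    case less
    then show ?thesis
      using forward[OF st _ \<epsilon>] sign by (simp add: closed_segment_eq_real_ivl)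
  next
    case equal
    then show ?thesis by simp
  next
    \<comment> \<open>Exchanging the endpoints changes the sign of the differences and of the
      oriented integrals alike.\<close>
    case greater
    have F: "?conclusion t s \<epsilon>"
      using forward[OF st(2,1) greater \<epsilon>] sign greater by (simp add: closed_segment_eq_real_ivl)
    show ?thesis
    proof (cases "c = 0")
      case True
      with F have "u s = u t" "v s - v t = \<epsilon> * (s - t) / sqrt (form_G (rev_H r) (u t) 0)"
        by simp_all
      moreover from this(2) have "v t - v s = \<epsilon> * (t - s) / sqrt (form_G (rev_H r) (u t) 0)"
        by (simp add: algebra_simps diff_divide_distrib)
      ultimately show ?thesis using True by simp
    next
      case False
      note F = F[unfolded if_not_P[OF False]]
      have "v t - v s = - (v s - v t)" "t - s = - (s - t)"
        by simp_all
      then show ?thesis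
        unfolding if_not_P[OF False] conjunct1[OF F] conjunct2[OF F]
          interval_integral_endpoints_reverse[of "ereal (u s)"]
        by blast
    qed
  qed
  then show ?thesis
    unfolding given_by_quadratures_def by blast
qed

end

theorem proposition28:
  fixes r :: "real \<Rightarrow> real" and U :: "real set"
  assumes "open U" "connected U"
    and "smooth_on U r"
    and "\<And>u. u \<in> U \<Longrightarrow> r u > 0"
    and "\<And>u. u \<in> U \<Longrightarrow> \<bar>deriv r u\<bar> < 1"
    and "\<And>u. u \<in> U \<Longrightarrow> 1 - (deriv r u)\<^sup>2 - r u * deriv (deriv r) u \<noteq> 0"
    and "\<And>u v. u \<in> U \<Longrightarrow> \<not> umbilic_point (rev_H r) (rev_N r) u v"
    and "\<And>u. u \<in> U \<Longrightarrow> rev_k2 r u > rev_k1 r u"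
  shows
    \<comment> \<open>the two expressions for the integral agree, and \<open>h\<close> is the distance to the axis\<close>
    "(\<forall>u\<in>U. \<forall>v \<alpha>. rev_h r u = infdist (rev_H r u v) rev_axis \<and>
        darboux_integral r u \<alpha> = rev_h r u * (rev_k1 r u - rev_k2 r u) * cos \<alpha> ^ 3)
     \<and> \<comment> \<open>first integral of the differential equation\<close>
     (\<forall>J u v \<alpha>. open J \<and> connected J \<and> u ` J \<subseteq> U \<and>
        darboux_ode_solution (rev_H r) (\<lambda>u v. rev_k1 r u) (\<lambda>u v. rev_k2 r u) J u v \<alpha> \<longrightarrow>
        (\<lambda>s. darboux_integral r (u s) (\<alpha> s)) constant_on J)
     \<and> \<comment> \<open>integration of the Darboux curves by quadratures\<close>
     (\<forall>J u v \<alpha>. open J \<and> connected J \<and> u ` J \<subseteq> U \<and>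
        smooth_on J u \<and> smooth_on J v \<and> smooth_on J \<alpha> \<and>
        arc_length_with_angle (rev_H r) J u v \<alpha> \<and> darboux_curve_on (rev_H r) J u v \<longrightarrow>
        (\<exists>c. (\<forall>s\<in>J. darboux_integral r (u s) (\<alpha> s) = c) \<and> given_by_quadratures r c J u v \<alpha>))
     \<and> \<comment> \<open>the ridge set and its types\<close>
     (\<forall>u\<in>U. \<forall>v. ridge_point (\<lambda>u v. rev_k1 r u) u v \<longleftrightarrow> ridge_function r u = 0)
     \<and>
     (\<forall>u\<in>U. \<forall>v. ridge_point (\<lambda>u v. rev_k1 r u) u v \<and> deriv (ridge_function r) u < 0 \<longrightarrow>
        zigzag_ridge_point (\<lambda>u v. rev_k1 r u) (\<lambda>u v. rev_k2 r u) u v)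
     \<and>
     (\<forall>u\<in>U. \<forall>v. ridge_point (\<lambda>u v. rev_k1 r u) u v \<and> deriv (ridge_function r) u > 0 \<longrightarrow>
        beak_to_beak_ridge_point (\<lambda>u v. rev_k1 r u) (\<lambda>u v. rev_k2 r u) u v)"
proof -
  interpret revolution_envelope r U
    using assms(1,3-6,8) by unfold_locales
  have curve: "unit_speed_curve r U J u v \<alpha>"
    if "open J" "u ` J \<subseteq> U" "arc_length_with_angle (rev_H r) J u v \<alpha>" for J u v \<alpha>
    using that by unfold_locales blast+
  have first_integral: "(\<lambda>s. darboux_integral r (u s) (\<alpha> s)) constant_on J"
    if "open J" "connected J" "u ` J \<subseteq> U"
      "darboux_ode_solution (rev_H r) (\<lambda>u v. rev_k1 r u) (\<lambda>u v. rev_k2 r u) J u v \<alpha>" for J u v \<alpha>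
  proof -
    interpret unit_speed_curve r U J u v \<alpha>
      by (rule curve) (use that in \<open>simp_all add: darboux_ode_solution_def\<close>)
    show ?thesis
      by (rule darboux_integral_constant) (fact that)+
  qed
  have "\<exists>c. (\<forall>s\<in>J. darboux_integral r (u s) (\<alpha> s) = c) \<and> given_by_quadratures r c J u v \<alpha>"
    if J: "open J" "connected J" "u ` J \<subseteq> U" and smooth: "smooth_on J \<alpha>"
      and arc: "arc_length_with_angle (rev_H r) J u v \<alpha>"
      and darboux: "darboux_curve_on (rev_H r) J u v" for J u v \<alpha>
  proof -
    interpret unit_speed_curve r U J u v \<alpha>
      by (rule curve[OF J(1,3) arc])
    obtain c where c: "\<And>s. s \<in> J \<Longrightarrow> darboux_integral r (u s) (\<alpha> s) = c"
      using darboux_integral_constant[OF J(2) darboux_curve_ode[OF smooth darboux]]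
      unfolding constant_on_def by blast
    have "continuous_on J \<alpha>"
      by (intro continuous_at_imp_continuous_on ballI DERIV_isCont[OF smooth_angle_DERIV(1)[OF smooth]])
    with c show ?thesis
      using quadratures[OF J(2)] by blast
  qed
  note darboux_curves = this
  have distance: "rev_h r u = infdist (rev_H r u v) rev_axis"
    and integral: "darboux_integral r u \<alpha> = rev_h r u * (rev_k1 r u - rev_k2 r u) * cos \<alpha> ^ 3"
    if "u \<in> U" for u v \<alpha>
    using that by (simp_all add: rev_h_def infdist_rev_axis darboux_integral_def cos_rev_beta)
  show ?thesis
    by (intro conjI allI ballI impI; (elim conjE)?;
        rule distance integral first_integral darboux_curves ridge_point_iff ridge_types; assumption)
qed

end
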